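(* Let $\lambda$, $\delta$ and $\rho$ be three proper partitions. For every integer $n\geq \max(|\lambda|,|\delta|)$ let $\alpha_{\lambda\delta}^{\rho}(n)$ be the structure coefficient defined in the context (so $\alpha_{\lambda\delta}^{\rho}(n)=0$ when $|\rho|>n$). Then $$\alpha_{\lambda\delta}^{\rho}(n)=\begin{cases} 2^n n!\, f_{\lambda\delta}^{\rho}(n) & \text{if } n\geq |\rho|,\\ 0 & \text{if } n<|\rho|,\end{cases}$$ where $f_{\lambda\delta}^{\rho}(n)=\sum_{j=0}^{|\lambda|+|\delta|-|\rho|} a_j\,(n-|\rho|)_j$ is a polynomial in $n$ and the $a_j$ are non-negative rational numbers (independent of $n$).
   Context: A partition $\lambda=(\lambda_1\geq\lambda_2\geq\dots\geq\lambda_l\geq 1)$ has size $|\lambda|=\sum\lambda_i$ and length $l(\lambda)=l$; $m_i(\lambda)$ is the number of parts equal to $i$; $(1^j)$ is the partition with $j$ parts equal to $1$; $\lambda\cup\mu$ is the partition with $m_i(\lambda\cup\mu)=m_i(\lambda)+m_i(\mu)$ for all $i$. A partition is proper if it has no part equal to $1$. $(n)_k=n(n-1)\cdots(n-k+1)$. Coset-type of a permutation $\omega$ of $[2n]=\{1,\dots,2n\}$: form a graph with $2n$ vertices, the vertex $i$ carrying exterior label $i$ and interior label $\omega(i)$; for each $1\le k\le n$ join by an exterior edge the vertices with exterior labels $2k-1,2k$ and by an interior edge the vertices with interior labels $2k-1,2k$. The graph is a disjoint union of cycles of even lengths $2\mu_1\geq 2\mu_2\geq\cdots$, and the coset-type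 of $\omega$ is the partition $(\mu_1,\mu_2,\dots)$ of $n$. For a proper partition $\lambda$ with $|\lambda|\leq n$, let $K_\lambda(n)\in\mathbb{C}[\mathcal{S}_{2n}]$ be the sum of all permutations of $[2n]$ with coset-type $\lambda\cup(1^{n-|\lambda|})$. These elements form a basis of the Hecke algebra of $(\mathcal{S}_{2n},\mathcal{B}_n)$, $\mathcal{B}_n$ the hyperoctahedral group, and for proper $\lambda,\delta$ with $|\lambda|,|\delta|\le n$ the structure coefficients $\alpha_{\lambda\delta}^{\rho}(n)$ are defined by $K_\lambda(n)K_\delta(n)=\sum_{\rho \text{ proper},\,|\rho|\le n}\alpha_{\lambda\delta}^{\rho}(n)K_\rho(n)$ (product in the group algebra $\mathbb{C}[\mathcal{S}_{2n}]$), with $\alpha_{\lambda\delta}^{\rho}(n):=0$ if $|\rho|>n$. *)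

theory Defs
  imports
    Complex_Main
    "HOL-Library.Multiset"
    "HOL-Combinatorics.Permutations"
    "HOL-Computational_Algebra.Polynomial"
begin

text \<open>
  A partition is the multiset of its parts. Hence \<open>count lam i\<close> is $m_i(\lambda)$, \<open>lam + \<mu>\<close> is
  $\lambda\cup\mu$, \<open>\<Sum>\<^sub># lam\<close> is $|\lambda|$, and \<open>replicate_mset j 1\<close> is $(1^j)$.
\<close>

definition is_partition :: "nat multiset \<Rightarrow> bool" where
  "is_partition lam \<longleftrightarrow> 0 \<notin># lam"

definition proper_partition :: "nat multiset \<Rightarrow> bool" where
  "proper_partition lam \<longleftrightarrow> is_partition lam \<and> 1 \<notin># lam"

definition falling_factorial :: "'a::comm_ring_1 \<Rightarrow> nat \<Rightarrow> 'a" where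
  "falling_factorial x k = (\<Prod>i<k. x - of_nat i)"

definition label_pairs :: "nat \<Rightarrow> nat set set" where
  "label_pairs n = {{2 * k - 1, 2 * k} | k. 1 \<le> k \<and> k \<le> n}"

definition exterior_edges :: "nat \<Rightarrow> (nat \<times> nat) set" where
  "exterior_edges n = {(i, j) \<in> {1..2 * n} \<times> {1..2 * n}. {i, j} \<in> label_pairs n}"

definition interior_edges :: "nat \<Rightarrow> (nat \<Rightarrow> nat) \<Rightarrow> (nat \<times> nat) set" where
  "interior_edges n \<omega> = {(i, j) \<in> {1..2 * n} \<times> {1..2 * n}. {\<omega> i, \<omega> j} \<in> label_pairs n}"

definition coset_graph_components :: "nat \<Rightarrow> (nat \<Rightarrow> nat) \<Rightarrow> nat set set" where
  "coset_graph_components n \<omega> = {1..2 * n} // (exterior_edges n \<union> interior_edges n \<omega>)\<^sup>*"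

text \<open>
  Both edge relations are symmetric, so the reflexive transitive closure is connectedness.
  The graph is a multigraph in which each component is a cycle (a double edge being a cycle of
  length 2); the length $2\mu_i$ of a cycle is therefore its number of vertices.
\<close>

definition coset_type :: "nat \<Rightarrow> (nat \<Rightarrow> nat) \<Rightarrow> nat multiset" where
  "coset_type n \<omega> = image_mset (\<lambda>C. card C div 2) (mset_set (coset_graph_components n \<omega>))"

text \<open>
  An element of $\mathbb{C}[\mathcal{S}_{2n}]$ is given by its coefficient function, which is
  0 outside the permutations of $\{1,\dots,2n\}$.
\<close>

definition group_algebra_mult ::
  "nat \<Rightarrow> ((nat \<Rightarrow> nat) \<Rightarrow> complex) \<Rightarrow> ((nat \<Rightarrow> nat) \<Rightarrow> complex) \<Rightarrow> (nat \<Rightarrow> nat) \<Rightarrow> complex" where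
  "group_algebra_mult n x y =
     (\<lambda>\<omega>. \<Sum>(\<sigma>, \<tau>) | \<sigma> permutes {1..2 * n} \<and> \<tau> permutes {1..2 * n} \<and> \<sigma> \<circ> \<tau> = \<omega>. x \<sigma> * y \<tau>)"

definition K_sum :: "nat multiset \<Rightarrow> nat \<Rightarrow> (nat \<Rightarrow> nat) \<Rightarrow> complex" where
  "K_sum lam n =
     (\<lambda>\<omega>. if \<omega> permutes {1..2 * n} \<and> coset_type n \<omega> = lam + replicate_mset (n - \<Sum>\<^sub># lam) 1
           then 1 else 0)"

text \<open>
  Because the \<open>K_sum \<rho> n\<close> are a basis of the Hecke algebra, the coefficient family is
  determined by the expansion together with its vanishing off the index set. This vanishing
  includes the convention that the coefficient is 0 if $|\rho| > n$.
\<close>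

definition structure_coeff :: "nat multiset \<Rightarrow> nat multiset \<Rightarrow> nat multiset \<Rightarrow> nat \<Rightarrow> complex" where
  "structure_coeff lam \<delta> \<rho> n =
     (THE c. group_algebra_mult n (K_sum lam n) (K_sum \<delta> n) =
               (\<lambda>\<omega>. \<Sum>\<pi> | proper_partition \<pi> \<and> \<Sum>\<^sub># \<pi> \<le> n. c \<pi> * K_sum \<pi> n \<omega>) \<and>
             (\<forall>\<pi>. \<not> (proper_partition \<pi> \<and> \<Sum>\<^sub># \<pi> \<le> n) \<longrightarrow> c \<pi> = 0)) \<rho>"

end

(*
  Permutations are replaced by perfect matchings of {1..2n}: if \<epsilon> is the exterior matching and
  N = \<omega>^{-1} \<epsilon> the interior one, then a factorisation \<omega> = \<sigma> \<tau> with \<sigma>, \<tau> of given coset-types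
  amounts to a matching M = \<tau>^{-1} \<epsilon> with prescribed types of the pairs (\<epsilon>, M) and (M, N),
  and each M comes from 2^n n! permutations \<tau>.

  Alternating walks show that a pair of matchings is determined up to relabelling by its type.
  Now sort the M by the set J of edges in \<epsilon> \<inter> N that M avoids. Deleting the edges common to
  \<epsilon>, M and N shows that the number of M for a given J depends only on j = |J| and not on n;
  call it b_j. Since |\<epsilon> \<inter> N| = n - |\<rho>|, the number of all M is \<Sum>_j b_j binomial(n - |\<rho>|, j), that is,
  a_j = b_j / j!. After the deletion every edge of \<epsilon> is outside M or lies in M - N, whence
  |\<rho>| + j \<le> |\<delta>| + |\<lambda>| as soon as b_j \<noteq> 0.
*)

theory Submission
  imports Defs "HOL-Library.Disjoint_Sets" "HOL-Library.FuncSet"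
begin

section \<open>Perfect matchings\<close>

text \<open>Coset-type is invariant under multiplication on either side by the stabiliser of
  \<epsilon>, the hyperoctahedral group. A permutation \<tau> therefore matters only through its
  coset, which is the matching \<tau>^{-1} \<epsilon>, and the factor 2^n n! is the order of that
  stabiliser. Matchings live on arbitrary finite sets, so that common edges and their vertices can
  be deleted without renumbering what is left. Such a deletion loses 1-parts only, which is why all
  types are compared through their proper parts. The remaining pair of matchings depends on which
  edges were deleted, not just on how many; the classification by type removes this dependence. The
  structure coefficients are given by a definite description, so an expansion of the product is not
  enough: it has to be unique. Uniqueness requires that every proper partition of size at most n
  occurs as the proper part of a coset-type, and this is why alternating cycles of every length are
  constructed.\<close>

definition perfect_matching :: "'a set \<Rightarrow> 'a set set \<Rightarrow> bool" where
  "perfect_matching V P \<longleftrightarrow> finite V \<and> partition_on V P \<and> (\<forall>e\<in>P. card e = 2)"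

text \<open>The matching seen as a fixed-point-free involution. At a point that no edge covers the
  description has no witness and the value is unspecified.\<close>

definition partner :: "'a set set \<Rightarrow> 'a \<Rightarrow> 'a" where
  "partner P x = (THE y. {x, y} \<in> P)"

lemma perfect_matchingD:
  assumes "perfect_matching V P"
  shows "finite V" "finite P" "\<Union>P = V" "\<And>e. e \<in> P \<Longrightarrow> card e = 2"
    "\<And>e e'. e \<in> P \<Longrightarrow> e' \<in> P \<Longrightarrow> e \<noteq> e' \<Longrightarrow> e \<inter> e' = {}"
  using assms by (auto simp: perfect_matching_def partition_on_def disjoint_def dest: finite_UnionD)

lemma perfect_matchingI:
  assumes "finite V" "\<Union>P = V" "\<And>e. e \<in> P \<Longrightarrow> card e = 2"
    "\<And>e e'. e \<in> P \<Longrightarrow> e' \<in> P \<Longrightarrow> e \<noteq> e' \<Longrightarrow> e \<inter> e' = {}"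
  shows "perfect_matching V P"
  using assms by (force simp: perfect_matching_def partition_on_def disjoint_def)

lemma finite_perfect_matchings: "finite V \<Longrightarrow> finite {P. perfect_matching V P}"
  by (rule finite_subset[OF _ finitely_many_partition_on[of V]]) (auto simp: perfect_matching_def)

lemma card_perfect_matching:
  assumes "perfect_matching V P"
  shows "card V = 2 * card P"
proof -
  have "card V = (\<Sum>e\<in>P. card e)"
    using assms by (intro product_partition)
      (auto simp: perfect_matching_def intro: card_ge_0_finite)
  then show ?thesis
    using assms by (simp add: perfect_matching_def)
qed

lemma perfect_matching_Un:
  assumes "perfect_matching V P" "perfect_matching W Q" "V \<inter> W = {}"
  shows "perfect_matching (V \<union> W) (P \<union> Q)"
proof (rule perfect_matchingI)
  note DP = perfect_matchingD[OF assms(1)] and DQ = perfect_matchingD[OF assms(2)]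
  show "finite (V \<union> W)" "\<Union> (P \<union> Q) = V \<union> W"
    using DP(1,3) DQ(1,3) by auto
  show "card e = 2" if "e \<in> P \<union> Q" for e
    using that DP(4) DQ(4) by blast
  have "e \<inter> e' = {}" if "e \<in> P" "e' \<in> Q" for e e'
    using that DP(3) DQ(3) assms(3) by blast
  then show "e \<inter> e' = {}" if "e \<in> P \<union> Q" "e' \<in> P \<union> Q" "e \<noteq> e'" for e e'
    using that DP(5)[of e e'] DQ(5)[of e e'] by blast
qed

lemma perfect_matching_subset:
  assumes "perfect_matching V P" "Q \<subseteq> P"
  shows "perfect_matching (\<Union>Q) Q"
proof (rule perfect_matchingI)
  note D = perfect_matchingD[OF assms(1)]
  show "finite (\<Union>Q)"
    using D assms(2) by (meson Union_mono finite_subset)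
qed (use perfect_matchingD[OF assms(1)] assms(2) in auto)

lemma perfect_matching_Diff:
  assumes "perfect_matching V P" "Q \<subseteq> P"
  shows "perfect_matching (V - \<Union>Q) (P - Q)"
proof -
  have "\<Union>(P - Q) = V - \<Union>Q"
    using perfect_matchingD[OF assms(1)] assms(2) by blast
  then show ?thesis
    using perfect_matching_subset[OF assms(1), of "P - Q"] by auto
qed

lemma perfect_matching_image:
  assumes "perfect_matching V P" "inj_on f V"
  shows "perfect_matching (f ` V) ((`) f ` P)"
proof (rule perfect_matchingI)
  note D = perfect_matchingD[OF assms(1)]
  show "finite (f ` V)" "\<Union> ((`) f ` P) = f ` V"
    using D by auto
  show "card e = 2" if "e \<in> (`) f ` P" for e
    using that D(3,4) by (auto simp: card_image inj_on_subset[OF assms(2)] Sup_upper)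
  show "e \<inter> e' = {}" if e: "e \<in> (`) f ` P" "e' \<in> (`) f ` P" "e \<noteq> e'" for e e'
  proof -
    obtain d d' where d: "d \<in> P" "d' \<in> P" "e = f ` d" "e' = f ` d'"
      using e by blast
    moreover have "d \<subseteq> V" "d' \<subseteq> V"
      using d D(3) by auto
    moreover have "d \<inter> d' = {}"
      using D(5)[of d d'] d e(3) by auto
    ultimately show ?thesis
      using inj_on_image_Int[OF assms(2), of d d'] by simp
  qed
qed

section \<open>The involution attached to a perfect matching\<close>

lemma partner_eqI:
  assumes "perfect_matching V P" "{x, y} \<in> P"
  shows "partner P x = y"
  unfolding partner_def
proof (rule the_equality)
  note D = perfect_matchingD[OF assms(1)]
  show "z = y" if "{x, z} \<in> P" for z
    using D(4)[OF that] D(4)[OF assms(2)] D(5)[OF that assms(2)]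
    by (auto simp: card_2_iff doubleton_eq_iff)
qed (rule assms)

lemma partner_edge:
  assumes "perfect_matching V P" "x \<in> V"
  shows "{x, partner P x} \<in> P"
proof -
  note D = perfect_matchingD[OF assms(1)]
  obtain e where e: "e \<in> P" "x \<in> e"
    using D(3) assms(2) by auto
  then obtain y where "e = {x, y}"
    using D(4)[OF e(1)] by (auto simp: card_2_iff)
  then show ?thesis
    using e(1) partner_eqI[OF assms(1)] by auto
qed

lemma partner_props:
  assumes "perfect_matching V P" "x \<in> V"
  shows "partner P x \<in> V" "partner P x \<noteq> x" "partner P (partner P x) = x"
proof -
  note D = perfect_matchingD[OF assms(1)]
  have e: "{x, partner P x} \<in> P"
    by (rule partner_edge[OF assms])
  then show "partner P x \<in> V" "partner P x \<noteq> x"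
    using D(3) D(4)[OF e] by auto
  show "partner P (partner P x) = x"
    using e by (intro partner_eqI[OF assms(1)]) (simp add: insert_commute)
qed

lemma perfect_matching_eq_partner:
  assumes "perfect_matching V P"
  shows "P = (\<lambda>x. {x, partner P x}) ` V"
proof
  note D = perfect_matchingD[OF assms]
  show "P \<subseteq> (\<lambda>x. {x, partner P x}) ` V"
  proof
    fix e assume e: "e \<in> P"
    then obtain x y where xy: "e = {x, y}"
      using D(4) by (metis card_2_iff)
    then have "x \<in> V" "partner P x = y"
      using e D(3) partner_eqI[OF assms] by auto
    then show "e \<in> (\<lambda>x. {x, partner P x}) ` V"
      using xy by auto
  qed
qed (use partner_edge[OF assms] in auto)

text \<open>A matching is the set of orbits of its involution, so a surjection that intertwines the
  two involutions carries one matching onto the other.\<close>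

lemma perfect_matching_image_eqI:
  assumes "perfect_matching V P" "perfect_matching V' P'" "f ` V = V'"
    and "\<And>x. x \<in> V \<Longrightarrow> f (partner P x) = partner P' (f x)"
  shows "(`) f ` P = P'"
proof -
  have "(`) f ` P = (\<lambda>x. {f x, partner P' (f x)}) ` V"
    by (subst perfect_matching_eq_partner[OF assms(1)]) (auto simp: image_image assms(4))
  also have "\<dots> = (\<lambda>y. {y, partner P' y}) ` V'"
    using assms(3) by auto
  also have "\<dots> = P'"
    using perfect_matching_eq_partner[OF assms(2)] by simp
  finally show ?thesis .
qed

section \<open>Components of a graph and the type of a pair of matchings\<close>

definition adj :: "'a set set \<Rightarrow> ('a \<times> 'a) set" where
  "adj E = {(x, y). {x, y} \<in> E}"

definition component :: "'a set set \<Rightarrow> 'a \<Rightarrow> 'a set" where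
  "component E x = (adj E)\<^sup>* `` {x}"

text \<open>The vertex set is read off from the edges; a union of perfect matchings covers every
  vertex, so no isolated point is missed.\<close>

definition comps :: "'a set set \<Rightarrow> 'a set set" where
  "comps E = component E ` \<Union>E"

text \<open>In the set \<open>P \<union> Q\<close> a common edge, which is a double edge of the
  multigraph, appears once; its component still has two vertices and gives the part 1.\<close>

definition mtype :: "'a set set \<Rightarrow> 'a set set \<Rightarrow> nat multiset" where
  "mtype P Q = image_mset (\<lambda>C. card C div 2) (mset_set (comps (P \<union> Q)))"

section \<open>Elementary properties of connected components\<close>

lemma sym_adj: "sym (adj E)"
  by (auto simp: adj_def sym_def insert_commute)

lemma component_self: "x \<in> component E x"
  by (auto simp: component_def)

lemma component_eq: "y \<in> component E x \<Longrightarrow> component E y = component E x"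
  using sym_rtrancl[OF sym_adj[of E]] by (auto simp: component_def sym_def intro: rtrancl_trans)

lemma component_step: "y \<in> component E x \<Longrightarrow> {y, z} \<in> E \<Longrightarrow> z \<in> component E x"
  by (auto simp: component_def adj_def intro: rtrancl_into_rtrancl)

lemma component_subsetI:
  assumes "x \<in> S" "\<And>y z. y \<in> S \<Longrightarrow> {y, z} \<in> E \<Longrightarrow> z \<in> S"
  shows "component E x \<subseteq> S"
proof -
  have "y \<in> S" if "(x, y) \<in> (adj E)\<^sup>*" for y
    using that by induction (use assms in \<open>auto simp: adj_def\<close>)
  then show ?thesis
    by (auto simp: component_def)
qed

lemma component_subset: "x \<in> \<Union>E \<Longrightarrow> component E x \<subseteq> \<Union>E"
  by (rule component_subsetI) auto

lemma Union_comps: "\<Union>(comps E) = \<Union>E"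
  using component_subset[of _ E] component_self[of _ E] unfolding comps_def by blast

lemma comps_eqI: "C \<in> comps E \<Longrightarrow> x \<in> C \<Longrightarrow> C = component E x"
  by (auto simp: comps_def component_eq)

lemma partition_on_comps: "partition_on (\<Union>E) (comps E)"
proof (rule partition_onI)
  show "{} \<notin> comps E"
    using component_self by (fastforce simp: comps_def)
  show "disjnt C D" if "C \<in> comps E" "D \<in> comps E" "C \<noteq> D" for C D
    using that comps_eqI unfolding disjnt_iff by metis
qed (rule Union_comps)

lemma finite_comps: "finite (\<Union>E) \<Longrightarrow> finite (comps E)"
  by (simp add: comps_def)

lemma comps_Un:
  assumes "\<Union>E \<inter> \<Union>F = {}"
  shows "comps (E \<union> F) = comps E \<union> comps F"
proof -
  have *: "component (E \<union> F) x = component E x" if "x \<in> \<Union>E" "\<Union>E \<inter> \<Union>F = {}" for E F :: "'a set set" and x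
  proof
    show "component (E \<union> F) x \<subseteq> component E x"
    proof (rule component_subsetI)
      fix y z assume yz: "y \<in> component E x" "{y, z} \<in> E \<union> F"
      then have "y \<in> \<Union>E"
        using component_subset[OF that(1)] by auto
      then have "{y, z} \<in> E"
        using yz(2) that(2) by auto
      then show "z \<in> component E x"
        using yz(1) component_step by metis
    qed (rule component_self)
    show "component E x \<subseteq> component (E \<union> F) x"
      by (rule component_subsetI) (auto intro: component_self component_step)
  qed
  have "component (E \<union> F) ` \<Union>E = comps E"
    using *[OF _ assms] by (auto simp: comps_def)
  moreover have "component (E \<union> F) ` \<Union>F = comps F"
    using *[of _ F E] assms by (auto simp: comps_def Un_commute Int_commute)
  ultimately show ?thesis
    by (simp add: comps_def image_Un Un_commute)
qed

text \<open>Matchings on disjoint ground sets do not interact: the alternating cycles of the union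
  are those of the two pairs.\<close>

lemma mtype_Un:
  assumes "perfect_matching V P" "perfect_matching V Q"
    and "perfect_matching W R" "perfect_matching W S" "V \<inter> W = {}"
  shows "mtype (P \<union> R) (Q \<union> S) = mtype P Q + mtype R S"
proof -
  note D = assms(1-4)[THEN perfect_matchingD(1)] assms(1-4)[THEN perfect_matchingD(3)]
  have U: "\<Union>(P \<union> Q) = V" "\<Union>(R \<union> S) = W"
    using D by auto
  have "comps (P \<union> R \<union> (Q \<union> S)) = comps ((P \<union> Q) \<union> (R \<union> S))"
    by (rule arg_cong[of _ _ comps]) blast
  also have "\<dots> = comps (P \<union> Q) \<union> comps (R \<union> S)"
    by (rule comps_Un) (simp only: U assms(5))
  finally have "comps (P \<union> R \<union> (Q \<union> S)) = comps (P \<union> Q) \<union> comps (R \<union> S)" .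
  moreover have "comps (P \<union> Q) \<inter> comps (R \<union> S) = {}"
  proof -
    have "\<Union>(comps (P \<union> Q)) \<inter> \<Union>(comps (R \<union> S)) = {}"
      by (simp only: Union_comps U assms(5))
    then have "C \<inter> D = {}" if "C \<in> comps (P \<union> Q)" "D \<in> comps (R \<union> S)" for C D
      using Union_upper[OF that(1)] Union_upper[OF that(2)] by blast
    \<comment> \<open>A shared component would be disjoint from itself, hence empty.\<close>
    then show ?thesis
      using partition_onD3[OF partition_on_comps[of "P \<union> Q"]] by (metis Int_absorb disjoint_iff)
  qed
  moreover have "finite (comps (P \<union> Q))" "finite (comps (R \<union> S))"
    using D U by (simp_all add: finite_comps)
  ultimately show ?thesis
    by (simp add: mtype_def mset_set_Union)
qed

lemma component_image:
  assumes "inj_on f (\<Union>E)" "x \<in> \<Union>E"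
  shows "component ((`) f ` E) (f x) = f ` component E x"
proof
  show "component ((`) f ` E) (f x) \<subseteq> f ` component E x"
  proof (rule component_subsetI)
    fix y z assume "y \<in> f ` component E x" "{y, z} \<in> (`) f ` E"
    then obtain u e where u: "u \<in> component E x" "y = f u" and e: "e \<in> E" "{y, z} = f ` e"
      by auto
    obtain w where w: "w \<in> e" "z = f w"
      using e(2) by (metis image_iff insertI1 insertI2)
    obtain u' where u': "u' \<in> e" "y = f u'"
      using e(2) by (metis image_iff insertI1)
    have "u \<in> \<Union>E"
      using u(1) component_subset[OF assms(2)] by auto
    then have uu: "u' = u"
      using inj_onD[OF assms(1), of u' u] u' u(2) e(1) by auto
    \<comment> \<open>\<open>E\<close> may hold sets of any size, so the preimage edge has to be
      shown to be \<open>{u, w}\<close>; injectivity of \<open>f\<close> leaves no third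
      point.\<close>
    have "e \<subseteq> {u, w}"
    proof
      fix v assume "v \<in> e"
      then have "f v = f u \<or> f v = f w"
        using e(2) u(2) w(2) by blast
      then show "v \<in> {u, w}"
        using inj_onD[OF assms(1)] \<open>v \<in> e\<close> e(1) w(1) u'(1) uu by blast
    qed
    then have "{u, w} \<in> E"
      using uu u'(1) w(1) e(1) by (metis insert_subset subset_antisym empty_subsetI)
    then show "z \<in> f ` component E x"
      using component_step[OF u(1)] w(2) by auto
  qed (simp add: component_self)
  have "component E x \<subseteq> {u. f u \<in> component ((`) f ` E) (f x)}"
  proof (rule component_subsetI)
    fix y z assume *: "y \<in> {u. f u \<in> component ((`) f ` E) (f x)}" "{y, z} \<in> E"
    have "f ` {y, z} \<in> (`) f ` E"
      using *(2) by (rule imageI)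
    then show "z \<in> {u. f u \<in> component ((`) f ` E) (f x)}"
      using *(1) component_step[of "f y" _ "f x" "f z"] by simp
  qed (simp add: component_self)
  then show "f ` component E x \<subseteq> component ((`) f ` E) (f x)"
    by auto
qed

lemma mtype_image:
  assumes "inj_on f (\<Union>(P \<union> Q))"
  shows "mtype ((`) f ` P) ((`) f ` Q) = mtype P Q"
proof -
  let ?E = "P \<union> Q"
  have c: "comps ((`) f ` ?E) = (`) f ` comps ?E"
  proof -
    have "comps ((`) f ` ?E) = (\<lambda>x. component ((`) f ` ?E) (f x)) ` \<Union>?E"
      unfolding comps_def by (auto simp: image_iff)
    also have "\<dots> = (\<lambda>x. f ` component ?E x) ` \<Union>?E"
      using component_image[OF assms] by (intro image_cong) auto
    finally show ?thesis
      by (simp add: comps_def image_image)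
  qed
  have sub: "C \<subseteq> \<Union>?E" if "C \<in> comps ?E" for C
    using that Union_comps[of ?E] by auto
  have inj: "inj_on ((`) f) (comps ?E)"
    using inj_on_image[of f "comps ?E"] assms by (simp add: Union_comps)
  have "mtype ((`) f ` P) ((`) f ` Q) = image_mset (\<lambda>C. card C div 2) (mset_set ((`) f ` comps ?E))"
    unfolding mtype_def image_Un[symmetric] c ..
  also have "\<dots> = image_mset (\<lambda>C. card (f ` C) div 2) (mset_set (comps ?E))"
    using image_mset_mset_set[OF inj] by (simp add: image_mset.compositionality component_def )
      (metis (no_types, lifting) comp_apply image_mset.compositionality image_mset_cong)
  also have "\<dots> = mtype P Q"
    unfolding mtype_def
  proof (rule image_mset_cong)
    fix C assume "C \<in># mset_set (comps ?E)"
    then have "C \<in> comps ?E"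
      by (metis elem_mset_set empty_iff infinite_set_mset_mset_set)
    then have "inj_on f C"
      using inj_on_subset[OF assms] sub by simp
    then show "card (f ` C) div 2 = card C div 2"
      by (simp add: card_image)
  qed
  finally show ?thesis .
qed

section \<open>Alternating walks\<close>

locale matching_pair =
  fixes V :: "'a set" and P Q :: "'a set set"
  assumes P: "perfect_matching V P" and Q: "perfect_matching V Q"
begin

lemma Union_edges: "\<Union>(P \<union> Q) = V"
  using perfect_matchingD(3)[OF P] perfect_matchingD(3)[OF Q] by auto

lemma finite_V: "finite V"
  using perfect_matchingD(1)[OF P] .

text \<open>Traverses the cycle through \<open>x\<close>, leaving \<open>x\<close> along its
  \<open>P\<close>-edge and using the two matchings in turn.\<close>

fun walk :: "'a \<Rightarrow> nat \<Rightarrow> 'a" where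
  "walk x 0 = x"
| "walk x (Suc n) = partner (if even n then P else Q) (walk x n)"

lemma pm: "perfect_matching V (if b then P else Q)"
  using P Q by simp

lemma walk_in: "x \<in> V \<Longrightarrow> walk x n \<in> V"
  by (induction n) (use partner_props(1)[OF pm] in auto)

lemma walk_pred: "x \<in> V \<Longrightarrow> partner (if even n then P else Q) (walk x (Suc n)) = walk x n"
  using partner_props(3)[OF pm walk_in] by simp

text \<open>Folding the two ends of a coincidence inwards ends in a fixed point of one of the matchings.\<close>

lemma walk_odd_neq: "x \<in> V \<Longrightarrow> walk x i \<noteq> walk x (i + 2 * k + 1)"
proof (induction k arbitrary: i)
  case 0
  then show ?case
    using partner_props(2)[OF pm walk_in, of x "even i" i] by simp
next
  case (Suc k)
  show ?case
  proof
    assume *: "walk x i = walk x (i + 2 * Suc k + 1)"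
    have "walk x (Suc i) = partner (if even i then P else Q) (walk x (Suc (i + 2 * Suc k)))"
      using * by simp
    also have "\<dots> = walk x (i + 2 * Suc k)"
      using walk_pred[OF Suc.prems, of "i + 2 * Suc k"] by simp
    finally show False
      using Suc.IH[OF Suc.prems, of "Suc i"] by simp
  qed
qed

text \<open>A coincidence at odd distance is excluded by \<open>walk_odd_neq\<close>. Parity decides
  which matching is used next, so coinciding vertices have the same continuation and the same past;
  this turns a coincidence into periodicity.\<close>

lemma walk_eq_imp_even:
  assumes "x \<in> V" "walk x i = walk x j"
  shows "even i = even j"
proof -
  have *: "even i = even j" if "i \<le> j" "walk x i = walk x j" for i j
  proof (rule ccontr)
    assume "even i \<noteq> even j"
    then have "odd (j - i)"
      using that(1) by auto
    then obtain k where "j - i = 2 * k + 1"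
      by (metis oddE)
    then have "j = i + 2 * k + 1"
      using that(1) by simp
    then show False
      using walk_odd_neq[OF assms(1)] that(2) by metis
  qed
  show ?thesis
    using *[of i j, OF _ assms(2)] *[of j i, OF _ assms(2)[symmetric]] by (meson nat_le_linear)
qed

lemma walk_shift:
  assumes "x \<in> V" "walk x i = walk x j"
  shows "walk x (i + k) = walk x (j + k)"
proof (induction k)
  case (Suc k)
  have "even (i + k) \<longleftrightarrow> even (j + k)"
    using walk_eq_imp_even[OF assms] unfolding even_add by blast
  then show ?case
    using Suc by simp
qed (simp add: assms)

lemma walk_back: "x \<in> V \<Longrightarrow> walk x (i + k) = walk x (j + k) \<Longrightarrow> walk x i = walk x j"
proof (induction k)
  case (Suc k)
  have even: "even (i + k) \<longleftrightarrow> even (j + k)"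
    using walk_eq_imp_even[OF Suc.prems] unfolding add_Suc_right even_Suc by blast
  have "walk x (i + k) = partner (if even (i + k) then P else Q) (walk x (Suc (i + k)))"
    by (rule walk_pred[OF Suc.prems(1), symmetric])
  also have "\<dots> = partner (if even (j + k) then P else Q) (walk x (Suc (j + k)))"
    by (simp only: even Suc.prems(2)[unfolded add_Suc_right])
  also have "\<dots> = walk x (j + k)"
    by (rule walk_pred[OF Suc.prems(1)])
  finally show ?case
    by (rule Suc.IH[OF Suc.prems(1)])
qed simp

lemma walk_diff:
  assumes "x \<in> V" "i < j" "walk x i = walk x j"
  shows "walk x (j - i) = x"
proof -
  have "walk x (j - i + i) = walk x (0 + i)"
    using assms(2,3) by simp
  then have "walk x (j - i) = walk x 0"
    by (rule walk_back[OF assms(1)])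
  then show ?thesis
    by simp
qed

definition period :: "'a \<Rightarrow> nat" where
  "period x = (LEAST L. L > 0 \<and> walk x L = x)"

text \<open>Finiteness of \<open>V\<close> forces a repetition. Since every step can be undone, the
  repetition can be pushed back to time 0, so the walk has no initial segment off the cycle.\<close>

lemma period: assumes "x \<in> V" shows "period x > 0" "walk x (period x) = x"
proof -
  have "range (walk x) \<subseteq> V"
    using walk_in[OF assms] by blast
  then have "finite (range (walk x))"
    by (rule finite_subset[OF _ finite_V])
  then have "\<not> inj (walk x)"
    by (metis range_inj_infinite)
  then obtain i j where neq: "i \<noteq> j" "walk x i = walk x j"
    unfolding inj_on_def by blast
  obtain i j where ij: "i < j" "walk x i = walk x j"
  proof (cases "i < j")
    case False
    then have "j < i"
      using neq(1) by simp
    then show thesis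
      by (rule that) (rule neq(2)[symmetric])
  next
    case True
    then show thesis
      by (rule that) (rule neq(2))
  qed
  have "j - i > 0"
    using ij(1) by simp
  then have "j - i > 0 \<and> walk x (j - i) = x"
    using walk_diff[OF assms ij] by (rule conjI)
  then have *: "period x > 0 \<and> walk x (period x) = x"
    unfolding period_def by (rule LeastI[of "\<lambda>L. L > 0 \<and> walk x L = x"])
  from * show "period x > 0"
    by (rule conjunct1)
  from * show "walk x (period x) = x"
    by (rule conjunct2)
qed

lemma walk_add_period:
  assumes "x \<in> V"
  shows "walk x (i + period x) = walk x i"
proof -
  have "walk x (period x) = walk x 0"
    using period(2)[OF assms] by simp
  then have "walk x (period x + i) = walk x (0 + i)"
    by (rule walk_shift[OF assms])
  then show ?thesis
    by (simp only: add.commute[of i] add_0)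
qed

lemma walk_mod_period: "x \<in> V \<Longrightarrow> walk x (i mod period x) = walk x i"
proof (induction i rule: less_induct)
  case (less i)
  show ?case
  proof (cases "i < period x")
    case False
    then have "walk x i = walk x (i - period x)"
      using walk_add_period[OF less.prems, of "i - period x"] by simp
    also have "\<dots> = walk x (i mod period x)"
      using less.IH[of "i - period x", OF _ less.prems] False period(1)[OF less.prems]
      by (simp only: le_mod_geq)
    finally show ?thesis ..
  qed simp
qed

lemma inj_on_walk:
  assumes "x \<in> V"
  shows "inj_on (walk x) {..<period x}"
proof -
  have *: False if "i < j" "j < period x" "walk x i = walk x j" for i j
  proof -
    have "walk x (j - i) = x"
      using walk_diff[OF assms that(1,3)] .
    moreover have "j - i > 0" "j - i < period x"
      using that by auto
    ultimately show False
      using not_less_Least[of "j - i" "\<lambda>L. L > 0 \<and> walk x L = x"] by (simp add: period_def)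
  qed
  show ?thesis
  proof (rule inj_onI)
    fix i j assume "i \<in> {..<period x}" "j \<in> {..<period x}" "walk x i = walk x j"
    then show "i = j"
      using *[of i j] *[of j i] by (metis lessThan_iff linorder_neqE_nat)
  qed
qed

lemma range_walk:
  assumes "x \<in> V"
  shows "range (walk x) = walk x ` {..<period x}"
proof -
  have "walk x i \<in> walk x ` {..<period x}" for i
  proof (rule image_eqI)
    show "walk x i = walk x (i mod period x)"
      by (rule walk_mod_period[OF assms, symmetric])
    show "i mod period x \<in> {..<period x}"
      using period(1)[OF assms] by simp
  qed
  then show ?thesis
    by blast
qed

text \<open>At even times the walk has arrived along \<open>Q\<close> and leaves along
  \<open>P\<close>, at odd times conversely. Positivity makes \<open>i - 1\<close> the actual
  predecessor.\<close>

lemma partner_walk: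
  assumes "x \<in> V" "i > 0"
  shows "partner P (walk x i) = walk x (if even i then Suc i else i - 1)"
    and "partner Q (walk x i) = walk x (if even i then i - 1 else Suc i)"
proof -
  obtain k where "i = Suc k"
    using assms(2) gr0_conv_Suc by auto
  then show "partner P (walk x i) = walk x (if even i then Suc i else i - 1)"
    and "partner Q (walk x i) = walk x (if even i then i - 1 else Suc i)"
    using walk_pred[OF assms(1), of k] by auto
qed

text \<open>Periodicity supplies predecessors, so the range of the walk is closed under both partner
  maps; walking in one direction therefore exhausts the component.\<close>

lemma component_walk:
  assumes "x \<in> V"
  shows "component (P \<union> Q) x = range (walk x)"
proof
  show "component (P \<union> Q) x \<subseteq> range (walk x)"
  proof (rule component_subsetI)
    show "x \<in> range (walk x)"
      by (rule range_eqI[of _ _ 0]) simp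
    fix y z assume "y \<in> range (walk x)" "{y, z} \<in> P \<union> Q"
    then obtain i where y: "y = walk x i"
      by auto
    \<comment> \<open>One extra period makes the index positive, so that \<open>partner_walk\<close>
      also covers the starting point.\<close>
    then have y: "y = walk x (i + period x)" and pos: "i + period x > 0"
      using walk_add_period[OF assms] period(1)[OF assms] by auto
    have "z = partner P y \<or> z = partner Q y"
      using \<open>{y, z} \<in> P \<union> Q\<close> partner_eqI[OF P] partner_eqI[OF Q] by blast
    then show "z \<in> range (walk x)"
      unfolding y partner_walk[OF assms pos] by blast
  qed
  have "walk x n \<in> component (P \<union> Q) x" for n
  proof (induction n)
    case (Suc n)
    have "{walk x n, walk x (Suc n)} \<in> P \<union> Q"
      using partner_edge[OF pm walk_in[OF assms], of n "even n"] by (auto split: if_splits)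
    then show ?case
      using Suc component_step by metis
  qed (simp add: component_self)
  then show "range (walk x) \<subseteq> component (P \<union> Q) x"
    by auto
qed

lemma card_component: "x \<in> V \<Longrightarrow> card (component (P \<union> Q) x) = period x"
  by (simp add: component_walk range_walk card_image inj_on_walk)

lemma even_period: "x \<in> V \<Longrightarrow> even (period x)"
  using walk_eq_imp_even[of x "period x" 0] period(2) by simp

lemma even_card_comps: "C \<in> comps (P \<union> Q) \<Longrightarrow> even (card C)"
  unfolding comps_def Union_edges using card_component even_period by auto

end

text \<open>Two cycles of equal length are identified by running their walks in parallel, from
  arbitrary starting points.\<close>

lemma component_isomorphism:
  assumes "matching_pair V P Q" "matching_pair V' P' Q'"
    and C: "C \<in> comps (P \<union> Q)" and C': "C' \<in> comps (P' \<union> Q')" and eq: "card C = card C'"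
  shows "\<exists>\<phi>. bij_betw \<phi> C C' \<and> (\<forall>u\<in>C. \<phi> (partner P u) = partner P' (\<phi> u) \<and>
    \<phi> (partner Q u) = partner Q' (\<phi> u))"
proof -
  interpret A: matching_pair V P Q by fact
  interpret B: matching_pair V' P' Q' by fact
  obtain x x' where x: "x \<in> V" "C = component (P \<union> Q) x" and x': "x' \<in> V'" "C' = component (P' \<union> Q') x'"
    using C C' unfolding comps_def A.Union_edges B.Union_edges by auto
  have L: "B.period x' = A.period x"
    using eq x x' A.card_component B.card_component by simp
  define L where "L = A.period x"
  \<comment> \<open>The inverse is taken on one period, where the walk is injective; equality of the
    periods extends the correspondence to all times.\<close>
  define \<phi> where "\<phi> = B.walk x' \<circ> the_inv_into {..<L} (A.walk x)"
  have \<phi>_walk: "\<phi> (A.walk x i) = B.walk x' i" for i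
  proof -
    have "\<phi> (A.walk x i) = \<phi> (A.walk x (i mod L))"
      using A.walk_mod_period[OF x(1)] by (simp add: L_def)
    also have "\<dots> = B.walk x' (i mod L)"
      using A.inj_on_walk[OF x(1)] A.period(1)[OF x(1)]
      by (simp add: \<phi>_def L_def the_inv_into_f_f)
    finally show ?thesis
      using B.walk_mod_period[OF x'(1)] L by (simp add: L_def)
  qed
  have "bij_betw \<phi> C C'"
    unfolding \<phi>_def
  proof (rule bij_betw_trans)
    show "bij_betw (the_inv_into {..<L} (A.walk x)) C {..<L}"
      unfolding x(2) A.component_walk[OF x(1)] A.range_walk[OF x(1)] L_def
      using A.inj_on_walk[OF x(1)] by (intro bij_betw_the_inv_into) (simp add: bij_betw_def)
    show "bij_betw (B.walk x') {..<L} C'"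
      unfolding x'(2) B.component_walk[OF x'(1)] B.range_walk[OF x'(1)] L_def
      using B.inj_on_walk[OF x'(1)] by (simp add: bij_betw_def L)
  qed
  moreover have "\<phi> (partner P u) = partner P' (\<phi> u) \<and> \<phi> (partner Q u) = partner Q' (\<phi> u)"
    if "u \<in> C" for u
  proof -
    obtain i where "u = A.walk x i"
      using \<open>u \<in> C\<close> unfolding x(2) A.component_walk[OF x(1)] by blast
    then have u: "u = A.walk x (i + L)" and pos: "i + L > 0"
      using A.walk_add_period[OF x(1)] A.period(1)[OF x(1)] by (auto simp: L_def)
    show ?thesis
      unfolding u \<phi>_walk A.partner_walk[OF x(1) pos] B.partner_walk[OF x'(1) pos] by simp
  qed
  ultimately show ?thesis
    by blast
qed

section \<open>The type classifies pairs of matchings\<close>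

text \<open>Turns equality of types into a bijection between components that respects the parts. The
  value \<open>f a\<close> must occur among the values of \<open>g\<close>, so some \<open>b\<close>
  with that value can be paired with \<open>a\<close> and both removed.\<close>

lemma image_mset_eq_imp_bij_betw:
  assumes "finite A" "finite B" "image_mset f (mset_set A) = image_mset g (mset_set B)"
  shows "\<exists>h. bij_betw h A B \<and> (\<forall>a\<in>A. g (h a) = f a)"
  using assms
proof (induction A arbitrary: B rule: finite_induct)
  case empty
  then have "mset_set B = {#}"
    by simp
  then have "B = {}"
    using empty.prems(1) by (simp add: mset_set_empty_iff)
  then show ?case
    by (simp add: bij_betw_def)
next
  case (insert a A)
  have "f a \<in># image_mset g (mset_set B)"
    using insert.hyps insert.prems(2)[symmetric] by simp
  then obtain b where b: "b \<in> B" "g b = f a"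
    using insert.prems(1) by auto
  have B: "mset_set B = add_mset b (mset_set (B - {b}))"
    using mset_set.remove[OF insert.prems(1) b(1)] by simp
  have "image_mset f (mset_set A) = image_mset g (mset_set (B - {b}))"
    using insert.hyps insert.prems(2) b(2) unfolding B by simp
  then obtain h where h: "bij_betw h A (B - {b})" "\<forall>a\<in>A. g (h a) = f a"
    using insert.IH[of "B - {b}"] insert.prems(1) by auto
  have "bij_betw (h(a := b)) A (B - {b})"
    using h(1) insert.hyps(2) by (subst bij_betw_cong[of A _ h]) auto
  then have "bij_betw (h(a := b)) (insert a A) (insert b (B - {b}))"
    using notIn_Un_bij_betw[of a A "h(a := b)" "B - {b}"] insert.hyps(2) by simp
  moreover have "insert b (B - {b}) = B"
    using b(1) by auto
  ultimately have "bij_betw (h(a := b)) (insert a A) B"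
    by simp
  moreover have "\<forall>c\<in>insert a A. g ((h(a := b)) c) = f c"
    using h(2) b(2) insert.hyps(2) by auto
  ultimately show ?case
    by blast
qed

text \<open>Equal types pair off the components by size, and the maps between paired cycles are
  glued.\<close>

lemma mtype_eq_imp_isomorphism:
  assumes pm: "perfect_matching V P" "perfect_matching V Q"
    "perfect_matching V' P'" "perfect_matching V' Q'"
    and eq: "mtype P Q = mtype P' Q'"
  shows "\<exists>\<phi>. bij_betw \<phi> V V' \<and> (`) \<phi> ` P = P' \<and> (`) \<phi> ` Q = Q'"
proof -
  interpret A: matching_pair V P Q
    using pm by unfold_locales
  interpret B: matching_pair V' P' Q'
    using pm by unfold_locales
  let ?E = "P \<union> Q" and ?E' = "P' \<union> Q'"
  have fin: "finite (comps ?E)" "finite (comps ?E')"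
    using A.finite_V B.finite_V by (simp_all only: finite_comps A.Union_edges B.Union_edges)
  obtain h where h: "bij_betw h (comps ?E) (comps ?E')"
      "\<forall>C\<in>comps ?E. card (h C) div 2 = card C div 2"
    using image_mset_eq_imp_bij_betw[OF fin eq[unfolded mtype_def]] by blast
  have hC: "h C \<in> comps ?E'" if "C \<in> comps ?E" for C
    using h(1) that by (rule bij_betwE[rule_format])
  have "\<exists>\<phi>. bij_betw \<phi> C (h C) \<and> (\<forall>u\<in>C. \<phi> (partner P u) = partner P' (\<phi> u) \<and>
    \<phi> (partner Q u) = partner Q' (\<phi> u))" if "C \<in> comps ?E" for C
  proof (rule component_isomorphism[OF A.matching_pair_axioms B.matching_pair_axioms that hC[OF that]])
    \<comment> \<open>The type records only halves of the component sizes; evenness recovers the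
      sizes.\<close>
    have "even (card C)" "even (card (h C))" "card (h C) div 2 = card C div 2"
      using A.even_card_comps[OF that] B.even_card_comps[OF hC[OF that]] h(2) that by auto
    then show "card C = card (h C)"
      by (metis dvd_mult_div_cancel)
  qed
  then obtain \<psi> where \<psi>: "\<And>C. C \<in> comps ?E \<Longrightarrow> bij_betw (\<psi> C) C (h C)"
    "\<And>C u. C \<in> comps ?E \<Longrightarrow> u \<in> C \<Longrightarrow> \<psi> C (partner P u) = partner P' (\<psi> C u)"
    "\<And>C u. C \<in> comps ?E \<Longrightarrow> u \<in> C \<Longrightarrow> \<psi> C (partner Q u) = partner Q' (\<psi> C u)"
    by metis
  define \<phi> where "\<phi> x = \<psi> (component ?E x) x" for x
  have cV: "component ?E x \<in> comps ?E" if "x \<in> V" for x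
    using that by (simp only: comps_def A.Union_edges imageI)
  have \<phi>C: "\<phi> x \<in> h (component ?E x)" if "x \<in> V" for x
    unfolding \<phi>_def using \<psi>(1)[OF cV[OF that]] component_self[of x ?E] by (metis bij_betwE)
  have sub: "C \<subseteq> V'" if "C \<in> comps ?E'" for C
    using that Union_upper[OF that] by (simp only: Union_comps B.Union_edges)
  have "inj_on \<phi> V"
  proof (rule inj_onI)
    fix x y assume xy: "x \<in> V" "y \<in> V" "\<phi> x = \<phi> y"
    \<comment> \<open>The image of a vertex lies in the component assigned by \<open>h\<close>, so
      equal images force the same component, on which the local map is injective.\<close>
    have "h (component ?E x) = h (component ?E y)"
      using comps_eqI[OF hC[OF cV[OF xy(1)]] \<phi>C[OF xy(1)]]
        comps_eqI[OF hC[OF cV[OF xy(2)]] \<phi>C[OF xy(2)]] xy(3) by simp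
    then have c: "component ?E x = component ?E y"
      by (rule inj_onD[OF bij_betw_imp_inj_on[OF h(1)] _ cV[OF xy(1)] cV[OF xy(2)]])
    have "x \<in> component ?E y"
      using component_self[of x ?E] unfolding c .
    with xy(3) show "x = y"
      using inj_onD[OF bij_betw_imp_inj_on[OF \<psi>(1)[OF cV[OF xy(2)]]]] component_self[of y ?E]
      unfolding \<phi>_def c by blast
  qed
  moreover have "\<phi> ` V = V'"
  proof
    show "\<phi> ` V \<subseteq> V'"
      using \<phi>C sub hC cV by blast
    show "V' \<subseteq> \<phi> ` V"
    proof
      fix y assume y: "y \<in> V'"
      have "component ?E' y \<in> comps ?E'"
        using y by (simp only: comps_def B.Union_edges imageI)
      then obtain C where C: "C \<in> comps ?E" "component ?E' y = h C"
        using h(1) by (metis bij_betw_imp_surj_on image_iff)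
      then have "y \<in> \<psi> C ` C"
        using \<psi>(1)[OF C(1)] component_self[of y ?E'] by (simp add: bij_betw_def)
      then obtain u where u: "u \<in> C" "y = \<psi> C u"
        by blast
      then have "y = \<phi> u"
        using comps_eqI[OF C(1)] by (simp add: \<phi>_def)
      moreover have "u \<in> V"
        using u(1) Union_upper[OF C(1)] by (auto simp only: Union_comps A.Union_edges)
      ultimately show "y \<in> \<phi> ` V"
        by (rule image_eqI)
    qed
  qed
  moreover have "(`) \<phi> ` P = P'"
  proof (rule perfect_matching_image_eqI[OF pm(1,3) \<open>\<phi> ` V = V'\<close>])
    fix x assume x: "x \<in> V"
    have "partner P x \<in> component ?E x"
      using partner_edge[OF pm(1) x] by (intro component_step[OF component_self]) blast
    then show "\<phi> (partner P x) = partner P' (\<phi> x)"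
      using \<psi>(2)[OF cV[OF x] component_self] component_eq unfolding \<phi>_def by metis
  qed
  moreover have "(`) \<phi> ` Q = Q'"
  proof (rule perfect_matching_image_eqI[OF pm(2,4) \<open>\<phi> ` V = V'\<close>])
    fix x assume x: "x \<in> V"
    have "partner Q x \<in> component ?E x"
      using partner_edge[OF pm(2) x] by (intro component_step[OF component_self]) blast
    then show "\<phi> (partner Q x) = partner Q' (\<phi> x)"
      using \<psi>(3)[OF cV[OF x] component_self] component_eq unfolding \<phi>_def by metis
  qed
  ultimately show ?thesis
    unfolding bij_betw_def by blast
qed

section \<open>The proper part of a type\<close>

text \<open>Undoes the padding by 1-parts. It is the part of a type that survives when common edges
  are deleted and the ground set shrinks.\<close>

definition proper_part :: "nat multiset \<Rightarrow> nat multiset" where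
  "proper_part T = filter_mset (\<lambda>k. k \<noteq> 1) T"

lemma proper_part_add: "proper_part T + replicate_mset (count T 1) 1 = T"
  by (rule multiset_eqI) (auto simp: proper_part_def)

lemma sum_proper_part: "\<Sum>\<^sub># T = \<Sum>\<^sub># (proper_part T) + count T 1"
proof -
  have "\<Sum>\<^sub># T = \<Sum>\<^sub># (proper_part T + replicate_mset (count T 1) 1)"
    by (simp only: proper_part_add)
  then show ?thesis
    by simp
qed

lemma proper_part_Un: "proper_part (S + T) = proper_part S + proper_part T"
  by (simp add: proper_part_def)

text \<open>Replaces the padded type in \<open>K_sum\<close> by a condition that does not mention
  n.\<close>

lemma proper_part_eq_iff:
  assumes "proper_partition \<pi>" "\<Sum>\<^sub># \<pi> \<le> \<Sum>\<^sub># T"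
  shows "T = \<pi> + replicate_mset (\<Sum>\<^sub># T - \<Sum>\<^sub># \<pi>) 1 \<longleftrightarrow> proper_part T = \<pi>"
proof
  assume T: "T = \<pi> + replicate_mset (\<Sum>\<^sub># T - \<Sum>\<^sub># \<pi>) 1"
  have "proper_part \<pi> = \<pi>"
    using assms(1) by (auto simp: proper_part_def proper_partition_def filter_mset_eq_conv)
  moreover have "proper_part (replicate_mset k 1) = {#}" for k
    by (auto simp: proper_part_def filter_mset_eq_conv)
  moreover have "proper_part T = proper_part (\<pi> + replicate_mset (\<Sum>\<^sub># T - \<Sum>\<^sub># \<pi>) 1)"
    by (rule arg_cong[OF T])
  ultimately show "proper_part T = \<pi>"
    by (simp add: proper_part_Un)
next
  assume "proper_part T = \<pi>"
  then show "T = \<pi> + replicate_mset (\<Sum>\<^sub># T - \<Sum>\<^sub># \<pi>) 1"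
    using proper_part_add[of T, symmetric] sum_proper_part[of T] by (simp only: add_diff_cancel_left')
qed

section \<open>Size, positivity and 1-parts of a type\<close>

context matching_pair
begin

lemma finite_comps_edges: "finite (comps (P \<union> Q))"
  using finite_V by (simp only: finite_comps Union_edges)

text \<open>Twice either side is the number of vertices; evenness of all components makes the
  halving exact.\<close>

lemma sum_mtype: "\<Sum>\<^sub># (mtype P Q) = card P"
proof -
  have fin: "finite C" if "C \<in> comps (P \<union> Q)" for C
    using finite_subset[OF Union_upper[OF that]] finite_V by (simp only: Union_comps Union_edges)
  have "2 * card P = card V"
    using card_perfect_matching[OF P] by simp
  also have "\<dots> = (\<Sum>C\<in>comps (P \<union> Q). card C)"
    using product_partition[OF partition_on_comps[of "P \<union> Q"] fin] by (simp only: Union_edges)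
  also have "\<dots> = (\<Sum>C\<in>comps (P \<union> Q). 2 * (card C div 2))"
    using even_card_comps by (intro sum.cong) auto
  also have "\<dots> = 2 * \<Sum>\<^sub># (mtype P Q)"
    unfolding mtype_def sum_distrib_left[symmetric] by (simp only: sum_unfold_sum_mset)
  finally show ?thesis
    by simp
qed

lemma zero_notin_mtype: "0 \<notin># mtype P Q"
proof
  assume "0 \<in># mtype P Q"
  then obtain C where C: "C \<in> comps (P \<union> Q)" "card C div 2 = 0"
    using finite_comps_edges by (auto simp: mtype_def)
  then have "card C = 0"
    using even_card_comps[OF C(1)] by (metis dvd_mult_div_cancel mult_0_right)
  moreover obtain x where "x \<in> V" "C = component (P \<union> Q) x"
    using C(1) unfolding comps_def Union_edges by auto
  ultimately show False
    using card_component[of x] period(1)[of x] by simp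
qed

lemma component_common_edge:
  assumes "e \<in> P \<inter> Q" "x \<in> e"
  shows "component (P \<union> Q) x = e"
proof
  show "component (P \<union> Q) x \<subseteq> e"
  proof (rule component_subsetI[OF assms(2)])
    fix y z assume yz: "y \<in> e" "{y, z} \<in> P \<union> Q"
    then have "{y, z} = e"
      using perfect_matchingD(5)[OF P, of "{y, z}" e] perfect_matchingD(5)[OF Q, of "{y, z}" e]
        assms(1) by blast
    then show "z \<in> e"
      by blast
  qed
  obtain y where "e = {x, y}"
    using perfect_matchingD(4)[OF P, of e] assms by (auto simp: card_2_iff)
  then show "e \<subseteq> component (P \<union> Q) x"
    using component_self[of x "P \<union> Q"] component_step[OF component_self, of x y "P \<union> Q"] assms(1)
    by auto
qed

text \<open>Both partners of a vertex lie in its component. If this has only two vertices the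
  partners coincide, which gives a common edge; conversely, disjointness of edges isolates a common
  edge from all others.\<close>

lemma comps_card_2: "{C \<in> comps (P \<union> Q). card C = 2} = P \<inter> Q"
proof (intro equalityI subsetI)
  fix e assume e: "e \<in> P \<inter> Q"
  then have c: "card e = 2"
    using perfect_matchingD(4)[OF P] by blast
  then obtain x where x: "x \<in> e"
    by (metis card.empty equals0I zero_neq_numeral)
  have "x \<in> \<Union>(P \<union> Q)"
    using e x by blast
  then have "e \<in> comps (P \<union> Q)"
    unfolding comps_def using component_common_edge[OF e x] by (metis imageI)
  then show "e \<in> {C \<in> comps (P \<union> Q). card C = 2}"
    using c by simp
next
  fix C assume "C \<in> {C \<in> comps (P \<union> Q). card C = 2}"
  then obtain x where x: "x \<in> V" "C = component (P \<union> Q) x" and c: "card C = 2"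
    unfolding comps_def Union_edges by auto
  have "finite C"
    using c by (metis card.infinite zero_neq_numeral)
  have *: "C = {x, partner M x}" if M: "perfect_matching V M" "M \<subseteq> P \<union> Q" for M
  proof (rule sym, rule card_subset_eq[OF \<open>finite C\<close>])
    have "{x, partner M x} \<in> P \<union> Q"
      using partner_edge[OF M(1) x(1)] M(2) by blast
    then have "partner M x \<in> component (P \<union> Q) x"
      by (rule component_step[OF component_self])
    then show "{x, partner M x} \<subseteq> C"
      unfolding x(2) using component_self by simp
    show "card {x, partner M x} = card C"
      using c partner_props(2)[OF M(1) x(1)] by simp
  qed
  have "C \<in> P"
    using *[OF P] partner_edge[OF P x(1)] by simp
  moreover have "C \<in> Q"
    using *[OF Q] partner_edge[OF Q x(1)] by simp
  ultimately show "C \<in> P \<inter> Q"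
    by simp
qed

lemma count_mtype_1: "count (mtype P Q) 1 = card (P \<inter> Q)"
proof -
  have "count (mtype P Q) 1 = card {C \<in> comps (P \<union> Q). card C div 2 = 1}"
    using finite_comps_edges
    by (simp add: mtype_def count_image_mset vimage_def Int_def conj_commute)
  also have "{C \<in> comps (P \<union> Q). card C div 2 = 1} = {C \<in> comps (P \<union> Q). card C = 2}"
  proof (rule Collect_cong, rule conj_cong[OF refl])
    fix C assume "C \<in> comps (P \<union> Q)"
    then have "even (card C)"
      by (rule even_card_comps)
    then show "card C div 2 = 1 \<longleftrightarrow> card C = 2"
      by presburger
  qed
  finally show ?thesis
    by (simp only: comps_card_2)
qed

text \<open>The 1-parts account for the common edges, so the other parts account for the rest of
  \<open>P\<close>. Applied to the pairs (P, M) and (M, Q), this yields the degree bound.\<close>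

lemma sum_proper_part_mtype: "\<Sum>\<^sub># (proper_part (mtype P Q)) = card (P - Q)"
proof -
  have "card (P \<inter> Q) + card (P - Q) = card ((P \<inter> Q) \<union> (P - Q))"
    using perfect_matchingD(2)[OF P] by (intro card_Un_disjoint[symmetric]) auto
  then have "card (P \<inter> Q) + card (P - Q) = card P"
    by (simp only: Int_Diff_Un)
  then show ?thesis
    using sum_proper_part[of "mtype P Q"] unfolding sum_mtype count_mtype_1 by linarith
qed

lemma proper_partition_mtype: "proper_partition (proper_part (mtype P Q))"
  using zero_notin_mtype by (auto simp: proper_partition_def is_partition_def proper_part_def)

end

lemma proper_part_mtype_self:
  assumes "perfect_matching V P"
  shows "proper_part (mtype P P) = {#}"
proof -
  interpret matching_pair V P P
    using assms by unfold_locales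
  have "\<Sum>\<^sub># (proper_part (mtype P P)) = 0"
    by (simp add: sum_proper_part_mtype)
  moreover have "0 \<notin># proper_part (mtype P P)"
    using zero_notin_mtype by (simp add: proper_part_def)
  ultimately show ?thesis
    by (metis multiset_nonemptyE sum_mset_0_iff)
qed

text \<open>Adding the edges of \<open>R\<close> to both matchings creates only double edges, which
  the proper part forgets.\<close>

lemma proper_part_mtype_Un:
  assumes "perfect_matching V P" "perfect_matching V Q" "perfect_matching W R" "V \<inter> W = {}"
  shows "proper_part (mtype (P \<union> R) (Q \<union> R)) = proper_part (mtype P Q)"
  by (simp add: mtype_Un[OF assms(1-3,3,4)] proper_part_Un proper_part_mtype_self[OF assms(3)])

section \<open>Every partition is a type\<close>

text \<open>Start 1 gives the label pairs. The free start also provides the matching shifted by one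
  from which a cycle is built, and room to place cycles side by side.\<close>

definition blocks :: "nat \<Rightarrow> nat \<Rightarrow> nat set set" where
  "blocks s m = (\<lambda>k. {s + 2 * k, s + 2 * k + 1}) ` {..<m}"

lemma perfect_matching_blocks: "perfect_matching {s..<s + 2 * m} (blocks s m)"
proof (rule perfect_matchingI)
  show "\<Union>(blocks s m) = {s..<s + 2 * m}"
  proof
    show "{s..<s + 2 * m} \<subseteq> \<Union>(blocks s m)"
    proof
      fix x assume x: "x \<in> {s..<s + 2 * m}"
      define k where "k = (x - s) div 2"
      have "k < m" "x = s + 2 * k \<or> x = s + 2 * k + 1"
        using x unfolding k_def by auto
      then show "x \<in> \<Union>(blocks s m)"
        unfolding blocks_def by blast
    qed
  qed (auto simp: blocks_def)
  show "card e = 2" if "e \<in> blocks s m" for e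
    using that by (auto simp: blocks_def)
  show "e \<inter> e' = {}" if e: "e \<in> blocks s m" "e' \<in> blocks s m" "e \<noteq> e'" for e e'
  proof -
    obtain k l where kl: "e = {s + 2 * k, s + 2 * k + 1}" "e' = {s + 2 * l, s + 2 * l + 1}"
      using e(1,2) unfolding blocks_def by blast
    then have "k \<noteq> l"
      using e(3) by blast
    then have "s + 2 * k \<noteq> s + 2 * l" "s + 2 * k \<noteq> s + 2 * l + 1" "s + 2 * k + 1 \<noteq> s + 2 * l"
      by presburger+
    then show ?thesis
      unfolding kl by auto
  qed
qed simp

lemma label_pairs_eq_blocks: "label_pairs n = blocks 1 n"
proof
  show "label_pairs n \<subseteq> blocks 1 n"
  proof
    fix e assume "e \<in> label_pairs n"
    then obtain k where "1 \<le> k" "k \<le> n" "e = {2 * k - 1, 2 * k}"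
      by (auto simp: label_pairs_def)
    then have "e = {1 + 2 * (k - 1), 1 + 2 * (k - 1) + 1}" "k - 1 \<in> {..<n}"
      by auto
    then show "e \<in> blocks 1 n"
      unfolding blocks_def by (rule image_eqI)
  qed
  show "blocks 1 n \<subseteq> label_pairs n"
  proof
    fix e assume "e \<in> blocks 1 n"
    then obtain k where "k < n" "e = {1 + 2 * k, 1 + 2 * k + 1}"
      unfolding blocks_def by blast
    then have "e = {2 * Suc k - 1, 2 * Suc k}" "1 \<le> Suc k" "Suc k \<le> n"
      by auto
    then show "e \<in> label_pairs n"
      unfolding label_pairs_def by blast
  qed
qed

lemma perfect_matching_label_pairs: "perfect_matching {1..2 * n} (label_pairs n)"
  using perfect_matching_blocks[of 1 n] by (simp add: label_pairs_eq_blocks atLeastLessThanSuc_atLeastAtMost)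

lemma exists_cycle:
  fixes s m :: nat
  assumes "m \<ge> 1"
  shows "\<exists>P Q. perfect_matching {s..<s + 2 * m} P \<and> perfect_matching {s..<s + 2 * m} Q \<and> mtype P Q = {#m#}"
proof -
  let ?V = "{s..<s + 2 * m}" and ?e = "{s, s + 2 * m - 1}"
  define P where "P = blocks s m"
  \<comment> \<open>The edges of \<open>blocks s m\<close> and \<open>blocks (s + 1) (m - 1)\<close>
    alternate along a path through all 2m vertices, and \<open>?e\<close> joins its ends. For m = 1
    the two matchings coincide.\<close>
  define Q where "Q = {?e} \<union> blocks (s + 1) (m - 1)"
  have P: "perfect_matching ?V P"
    unfolding P_def by (rule perfect_matching_blocks)
  have "perfect_matching ?e {?e}"
    using assms by (intro perfect_matchingI) auto
  then have "perfect_matching (?e \<union> {s + 1..<s + 1 + 2 * (m - 1)}) Q"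
    unfolding Q_def using assms by (intro perfect_matching_Un perfect_matching_blocks) auto
  moreover have "?e \<union> {s + 1..<s + 1 + 2 * (m - 1)} = ?V"
    using assms by auto
  ultimately have Q: "perfect_matching ?V Q"
    by simp
  interpret matching_pair ?V P Q
    using P Q by unfold_locales
  have edge: "{s + i, s + Suc i} \<in> P \<union> Q" if "Suc i < 2 * m" for i
  proof (cases "even i")
    case True
    then obtain k where "i = 2 * k"
      by blast
    with that have "{s + i, s + Suc i} = {s + 2 * k, s + 2 * k + 1}" "k \<in> {..<m}"
      by auto
    then show ?thesis
      unfolding P_def blocks_def by blast
  next
    case False
    then obtain k where "i = 2 * k + 1"
      by (rule oddE)
    with that have "{s + i, s + Suc i} = {s + 1 + 2 * k, s + 1 + 2 * k + 1}" "k \<in> {..<m - 1}"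
      by auto
    then show ?thesis
      unfolding Q_def blocks_def by blast
  qed
  have reach: "i < 2 * m \<Longrightarrow> s + i \<in> component (P \<union> Q) s" for i
  proof (induction i)
    case (Suc i)
    then show ?case
      using component_step[OF _ edge[of i], of s] by simp
  qed (simp add: component_self)
  have sV: "s \<in> ?V"
    using assms by simp
  have "component (P \<union> Q) s = ?V"
  proof
    show "component (P \<union> Q) s \<subseteq> ?V"
      using component_subset[of s "P \<union> Q"] sV by (simp only: Union_edges)
    show "?V \<subseteq> component (P \<union> Q) s"
    proof
      fix x assume "x \<in> ?V"
      then have "x - s < 2 * m" "s + (x - s) = x"
        by auto
      then show "x \<in> component (P \<union> Q) s"
        using reach[of "x - s"] by simp
    qed
  qed
  then have "component (P \<union> Q) x = ?V" if "x \<in> ?V" for x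
    using component_eq[of x "P \<union> Q" s] that by simp
  then have "comps (P \<union> Q) = {?V}"
    unfolding comps_def Union_edges using sV by blast
  then have "mtype P Q = {#m#}"
    by (simp add: mtype_def)
  then show ?thesis
    using P Q by blast
qed

text \<open>One cycle per part, each placed beyond the vertices already in use.\<close>

lemma exists_type:
  assumes "0 \<notin># T"
  shows "\<exists>V P Q. perfect_matching (V :: nat set) P \<and> perfect_matching V Q \<and> mtype P Q = T"
  using assms
proof (induction T)
  case empty
  have "perfect_matching {} {}" "mtype {} {} = {#}"
    by (auto simp: mtype_def comps_def intro!: perfect_matchingI)
  then show ?case
    by metis
next
  case (add m T)
  then obtain V P Q where VPQ: "perfect_matching (V :: nat set) P" "perfect_matching V Q" "mtype P Q = T"
    by auto
  obtain s where s: "\<And>v. v \<in> V \<Longrightarrow> v < s"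
    using perfect_matchingD(1)[OF VPQ(1)] finite_nat_set_iff_bounded[of V] by blast
  let ?W = "{s..<s + 2 * m}"
  obtain R S where RS: "perfect_matching ?W R" "perfect_matching ?W S" "mtype R S = {#m#}"
    using exists_cycle[of m s] add.prems by (auto simp: Suc_le_eq)
  have disj: "V \<inter> ?W = {}"
    using s by force
  have "mtype (P \<union> R) (Q \<union> S) = add_mset m T"
    using mtype_Un[OF VPQ(1,2) RS(1,2) disj] VPQ(3) RS(3) by simp
  then show ?case
    using perfect_matching_Un[OF VPQ(1) RS(1) disj] perfect_matching_Un[OF VPQ(2) RS(2) disj] by blast
qed

section \<open>Counting isomorphisms of perfect matchings\<close>

text \<open>Extensionality fixes the values off \<open>V\<close>, so that each map is counted
  once.\<close>

definition isos :: "'a set \<Rightarrow> 'a set set \<Rightarrow> 'b set \<Rightarrow> 'b set set \<Rightarrow> ('a \<Rightarrow> 'b) set" where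
  "isos V P V' P' = {h \<in> extensional V. bij_betw h V V' \<and> (`) h ` P = P'}"

lemma finite_isos: "finite V \<Longrightarrow> finite V' \<Longrightarrow> finite (isos V P V' P')"
  by (rule finite_subset[OF _ finite_PiE[of V "\<lambda>_. V'"]])
    (auto simp: isos_def PiE_def bij_betw_def)

text \<open>Once \<open>x\<close> goes to \<open>z\<close>, the partner of \<open>x\<close> has to
  go to the partner of \<open>z\<close>; what remains is an arbitrary isomorphism between the
  matchings with these edges removed.\<close>

lemma card_isos_fixed:
  assumes pm: "perfect_matching V P" "perfect_matching V' P'" and x: "x \<in> V" and z: "z \<in> V'"
  defines "e \<equiv> {x, partner P x}" and "e' \<equiv> {z, partner P' z}"
  shows "card {h \<in> isos V P V' P'. h x = z} = card (isos (V - e) (P - {e}) (V' - e') (P' - {e'}))"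
proof (rule bij_betw_same_card)
  let ?A = "{h \<in> isos V P V' P'. h x = z}"
  let ?B = "isos (V - e) (P - {e}) (V' - e') (P' - {e'})"
  let ?F = "\<lambda>h. restrict h (V - e)"
  let ?G = "\<lambda>g. g(x := z, partner P x := partner P' z)"
  have e: "e \<in> P" "e \<subseteq> V" and e': "e' \<in> P'" "e' \<subseteq> V'"
    using partner_edge[OF pm(1) x] partner_edge[OF pm(2) z] x z
      partner_props(1)[OF pm(1) x] partner_props(1)[OF pm(2) z] by (auto simp: e_def e'_def)
  have neq: "partner P x \<noteq> x" "partner P' z \<noteq> z"
    using partner_props(2)[OF pm(1) x] partner_props(2)[OF pm(2) z] by auto
  have P0: "d \<subseteq> V - e" if "d \<in> P - {e}" for d
    using that perfect_matchingD(3)[OF pm(1)] perfect_matchingD(5)[OF pm(1), of d e] e(1) by blast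
  have img: "h ` e = e'" if h: "h \<in> ?A" for h
  proof -
    have "h ` e \<in> P'"
      using h e(1) by (auto simp: isos_def)
    moreover have "h ` e = {z, h (partner P x)}"
      using h by (simp add: e_def)
    ultimately show ?thesis
      using partner_eqI[OF pm(2), of z "h (partner P x)"] by (simp add: e'_def)
  qed
  show "bij_betw ?F ?A ?B"
  proof (rule bij_betw_byWitness[where f' = ?G])
    show "\<forall>h\<in>?A. ?G (?F h) = h"
    proof
      fix h assume h: "h \<in> ?A"
      have "h (partner P x) = partner P' z"
      proof -
        have "h ` e = {z, h (partner P x)}"
          using h by (simp add: e_def)
        then show ?thesis
          using img[OF h] by (auto simp: e'_def doubleton_eq_iff)
      qed
      moreover have "h v = undefined" if "v \<notin> V" for v
        using h that by (simp add: isos_def extensional_def)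
      ultimately show "?G (?F h) = h"
        using h by (auto simp: fun_eq_iff e_def)
    qed
    show "\<forall>g\<in>?B. ?F (?G g) = g"
    proof
      fix g assume "g \<in> ?B"
      then have "g \<in> extensional (V - e)"
        by (simp add: isos_def)
      then have "g v = undefined" if "v \<notin> V - e" for v
        using that by (rule extensional_arb)
      then show "?F (?G g) = g"
        by (auto simp: fun_eq_iff e_def)
    qed
    show "?F ` ?A \<subseteq> ?B"
    proof
      fix g assume "g \<in> ?F ` ?A"
      then obtain h where h: "h \<in> ?A" and g: "g = ?F h"
        by blast
      have bij: "bij_betw h V V'" and hP: "(`) h ` P = P'"
        using h by (auto simp: isos_def)
      have inj: "inj_on h V"
        using bij by (rule bij_betw_imp_inj_on)
      have "h ` (V - e) = h ` V - h ` e"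
        using inj_on_image_set_diff[OF inj, of V e] e(2) by simp
      then have "bij_betw h (V - e) (V' - e')"
        using bij img[OF h] inj_on_subset[OF inj, of "V - e"] by (simp add: bij_betw_def)
      then have "bij_betw g (V - e) (V' - e')"
        unfolding g by (subst bij_betw_cong[of _ _ h]) auto
      moreover have "(`) g ` (P - {e}) = P' - {e'}"
      proof -
        have "(`) g ` (P - {e}) = (`) h ` (P - {e})"
        proof (rule image_cong[OF refl])
          fix d assume "d \<in> P - {e}"
          then show "g ` d = h ` d"
            unfolding g using P0 by (intro image_cong) auto
        qed
        also have "\<dots> = (`) h ` P - (`) h ` {e}"
        proof (rule inj_on_image_set_diff[OF inj_on_image_Pow[OF inj]])
          show "P - {e} \<subseteq> Pow V" "{e} \<subseteq> Pow V"
            using P0 e(2) by auto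
        qed
        finally show ?thesis
          using img[OF h] hP by simp
      qed
      ultimately show "g \<in> ?B"
        by (simp add: isos_def g)
    qed
    show "?G ` ?B \<subseteq> ?A"
    proof
      fix h assume "h \<in> ?G ` ?B"
      then obtain g where g: "g \<in> ?B" and h: "h = ?G g"
        by blast
      have bij: "bij_betw g (V - e) (V' - e')" and gP: "(`) g ` (P - {e}) = P' - {e'}"
        and ext: "g \<in> extensional (V - e)"
        using g by (auto simp: isos_def)
      have eq: "h v = g v" if "v \<in> V - e" for v
        using that by (simp add: h e_def)
      have "bij_betw h (V - e) (V' - e')"
        using bij by (subst bij_betw_cong[of _ _ g]) (auto simp: eq)
      moreover have hx: "h x = z" "h (partner P x) = partner P' z"
        using neq by (simp_all add: h)
      then have he: "bij_betw h e e'"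
        using neq by (auto simp: bij_betw_def e_def e'_def)
      ultimately have "bij_betw h (e \<union> (V - e)) (e' \<union> (V' - e'))"
        by (intro bij_betw_combine) auto
      then have "bij_betw h V V'"
        using e(2) e'(2) by (simp add: Un_absorb1)
      moreover have "(`) h ` P = P'"
      proof -
        have "(`) h ` (P - {e}) = (`) g ` (P - {e})"
        proof (rule image_cong[OF refl])
          fix d assume "d \<in> P - {e}"
          then show "h ` d = g ` d"
            using P0 eq by (intro image_cong) auto
        qed
        moreover have "P = insert e (P - {e})"
          using e(1) by blast
        ultimately have "(`) h ` P = insert (h ` e) (P' - {e'})"
          using gP by (metis image_insert)
        then show ?thesis
          using he e'(1) by (auto simp: bij_betw_def)
      qed
      moreover have "h \<in> extensional V"
        using ext x e by (auto simp: extensional_def h e_def)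
      ultimately show "h \<in> ?A"
        using hx(1) by (simp add: isos_def)
    qed
  qed
qed

text \<open>With n + 1 edges, a fixed vertex has 2(n + 1) possible images, and each choice leaves
  the count for n edges; this is the recursion of 2^n n!.\<close>

lemma card_isos:
  assumes "perfect_matching V P" "perfect_matching V' P'" "card P = n" "card P' = n"
  shows "card (isos V P V' P') = 2 ^ n * fact n"
  using assms
proof (induction n arbitrary: V P V' P')
  case 0
  then have "P = {}" "P' = {}"
    using "0.prems"(1,2)[THEN perfect_matchingD(2)] by simp_all
  moreover then have "V = {}" "V' = {}"
    using perfect_matchingD(3)[OF "0.prems"(1)] perfect_matchingD(3)[OF "0.prems"(2)] by auto
  ultimately have "isos V P V' P' = {\<lambda>_. undefined}"
    by (auto simp: isos_def bij_betw_def)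
  then show ?case
    by simp
next
  case (Suc n)
  note pm = Suc.prems(1,2)
  have cV: "card V = 2 * Suc n" "card V' = 2 * Suc n"
    using card_perfect_matching[OF pm(1)] card_perfect_matching[OF pm(2)] Suc.prems(3,4) by auto
  then obtain x where x: "x \<in> V"
    by (metis card.empty equals0I mult_is_0 nat.distinct(1) zero_neq_numeral)
  have fin: "finite V" "finite V'"
    using pm[THEN perfect_matchingD(1)] .
  have "isos V P V' P' = (\<Union>z\<in>V'. {h \<in> isos V P V' P'. h x = z})"
    using x by (auto simp: isos_def bij_betw_def)
  also have "card \<dots> = (\<Sum>z\<in>V'. card {h \<in> isos V P V' P'. h x = z})"
    using fin finite_isos[OF fin, of P P'] by (intro card_UN_disjoint) auto
  also have "\<dots> = (\<Sum>z\<in>V'. 2 ^ n * fact n)"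
  proof (rule sum.cong[OF refl])
    fix z assume z: "z \<in> V'"
    let ?e = "{x, partner P x}" and ?e' = "{z, partner P' z}"
    have e: "?e \<in> P" "?e' \<in> P'"
      using partner_edge[OF pm(1) x] partner_edge[OF pm(2) z] .
    have "perfect_matching (V - ?e) (P - {?e})" "perfect_matching (V' - ?e') (P' - {?e'})"
      using perfect_matching_Diff[OF pm(1), of "{?e}"] perfect_matching_Diff[OF pm(2), of "{?e'}"] e
      by simp_all
    moreover have "card (P - {?e}) = n" "card (P' - {?e'}) = n"
      using e Suc.prems(3,4) by (simp_all only: card_Diff_singleton)
    ultimately have "card (isos (V - ?e) (P - {?e}) (V' - ?e') (P' - {?e'})) = 2 ^ n * fact n"
      by (rule Suc.IH)
    then show "card {h \<in> isos V P V' P'. h x = z} = 2 ^ n * fact n"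
      by (simp only: card_isos_fixed[OF pm x z])
  qed
  also have "\<dots> = 2 ^ Suc n * fact (Suc n)"
    by (simp add: cV algebra_simps)
  finally show ?case .
qed

text \<open>The same count with maps continued by the identity off \<open>V\<close> instead of
  \<open>undefined\<close>. For equal matchings the set is a hyperoctahedral group, in general a
  coset of one.\<close>

lemma card_permutes_matching:
  assumes pm: "perfect_matching V P" "perfect_matching V P'"
  shows "card {\<tau>. \<tau> permutes V \<and> (`) \<tau> ` P = P'} = 2 ^ card P * fact (card P)"
proof -
  let ?A = "{\<tau>. \<tau> permutes V \<and> (`) \<tau> ` P = P'}"
  have sub: "d \<subseteq> V" if "d \<in> P" for d
    using that perfect_matchingD(3)[OF pm(1)] by blast
  have restr: "(`) h ` P = (`) g ` P" if "\<And>v. v \<in> V \<Longrightarrow> h v = g v" for h g :: "'a \<Rightarrow> 'a"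
    using that sub by (intro image_cong refl) blast
  have "bij_betw (\<lambda>h. restrict h V) ?A (isos V P V P')"
  proof (rule bij_betw_byWitness[where f' = "\<lambda>h v. if v \<in> V then h v else v"])
    show "\<forall>h\<in>?A. (\<lambda>v. if v \<in> V then restrict h V v else v) = h"
      by (auto simp: fun_eq_iff permutes_not_in)
    show "\<forall>h\<in>isos V P V P'. restrict (\<lambda>v. if v \<in> V then h v else v) V = h"
      by (auto simp: isos_def fun_eq_iff extensional_def)
    show "(\<lambda>h. restrict h V) ` ?A \<subseteq> isos V P V P'"
    proof
      fix g assume "g \<in> (\<lambda>h. restrict h V) ` ?A"
      then obtain h where h: "h permutes V" "(`) h ` P = P'" "g = restrict h V"
        by blast
      have "bij_betw g V V"
        using permutes_imp_bij[OF h(1)] unfolding h(3) by (subst bij_betw_cong[of _ _ h]) auto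
      moreover have "(`) g ` P = P'"
        using restr[of g h] h(2,3) by simp
      ultimately show "g \<in> isos V P V P'"
        by (simp add: isos_def h(3))
    qed
    show "(\<lambda>h v. if v \<in> V then h v else v) ` isos V P V P' \<subseteq> ?A"
    proof
      fix h assume "h \<in> (\<lambda>h v. if v \<in> V then h v else v) ` isos V P V P'"
      then obtain g where g: "bij_betw g V V" "(`) g ` P = P'" "h = (\<lambda>v. if v \<in> V then g v else v)"
        unfolding isos_def by blast
      have "bij_betw h V V"
        using g(1) unfolding g(3) by (subst bij_betw_cong[of _ _ g]) auto
      then have "h permutes V"
        by (rule bij_imp_permutes) (simp add: g(3))
      moreover have "(`) h ` P = P'"
        using restr[of h g] g(2,3) by simp
      ultimately show "h \<in> ?A"
        by blast
    qed
  qed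
  then have "card ?A = card (isos V P V P')"
    by (rule bij_betw_same_card)
  moreover have "card P' = card P"
    using card_perfect_matching[OF pm(1)] card_perfect_matching[OF pm(2)] by simp
  ultimately show ?thesis
    using card_isos[OF pm refl] by simp
qed

section \<open>Intermediate matchings\<close>

text \<open>\<open>P\<close> plays the role of \<epsilon> and \<open>Q\<close> that of N. The right
  factor of the product governs the pair (P, M), so \<delta> belongs to \<open>P\<close> and
  \<open>lam\<close> to \<open>Q\<close>.\<close>

definition intermediate :: "nat multiset \<Rightarrow> nat multiset \<Rightarrow> 'a set \<Rightarrow> 'a set set \<Rightarrow> 'a set set \<Rightarrow> 'a set set set" where
  "intermediate lam \<delta> V P Q =
     {M. perfect_matching V M \<and> proper_part (mtype P M) = \<delta> \<and> proper_part (mtype M Q) = lam}"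

text \<open>The matchings from which nothing more can be deleted. Their number is b_j when
  \<open>P\<close> and \<open>Q\<close> have j common edges and proper type \<rho>.\<close>

definition primitive :: "nat multiset \<Rightarrow> nat multiset \<Rightarrow> 'a set \<Rightarrow> 'a set set \<Rightarrow> 'a set set \<Rightarrow> 'a set set set" where
  "primitive lam \<delta> V P Q = {M \<in> intermediate lam \<delta> V P Q. P \<inter> Q \<inter> M = {}}"

lemma finite_intermediate: "finite V \<Longrightarrow> finite (intermediate lam \<delta> V P Q)"
  by (rule finite_subset[OF _ finite_perfect_matchings[of V]]) (auto simp: intermediate_def)

lemma primitive_bound:
  assumes P: "perfect_matching V P" and Q: "perfect_matching V Q" and M: "M \<in> primitive lam \<delta> V P Q"
  shows "card P \<le> \<Sum>\<^sub># lam + \<Sum>\<^sub># \<delta>"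
proof -
  have M': "perfect_matching V M" "proper_part (mtype P M) = \<delta>" "proper_part (mtype M Q) = lam"
    "P \<inter> Q \<inter> M = {}"
    using M by (auto simp: primitive_def intermediate_def)
  interpret PM: matching_pair V P M
    using P M'(1) by unfold_locales
  interpret MQ: matching_pair V M Q
    using Q M'(1) by unfold_locales
  have fin: "finite P" "finite M"
    using perfect_matchingD(2)[OF P] perfect_matchingD(2)[OF M'(1)] .
  have "card P \<le> card ((P - M) \<union> (M - Q))"
    using M'(4) fin by (intro card_mono) auto
  also have "\<dots> \<le> card (P - M) + card (M - Q)"
    by (rule card_Un_le)
  also have "\<dots> = \<Sum>\<^sub># lam + \<Sum>\<^sub># \<delta>"
    using PM.sum_proper_part_mtype MQ.sum_proper_part_mtype M'(2,3) by simp
  finally show ?thesis .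
qed

text \<open>An isomorphism of the pairs carries intermediate matchings along and preserves both
  types. An injection suffices, as the roles of the two pairs can be exchanged.\<close>

lemma card_primitive_le:
  assumes pm: "perfect_matching V P" "perfect_matching V Q"
    "perfect_matching V' P'" "perfect_matching V' Q'"
    and eq: "mtype P Q = mtype P' Q'"
  shows "card (primitive lam \<delta> V P Q) \<le> card (primitive lam \<delta> V' P' Q')"
proof -
  obtain \<phi> where \<phi>: "bij_betw \<phi> V V'" "(`) \<phi> ` P = P'" "(`) \<phi> ` Q = Q'"
    using mtype_eq_imp_isomorphism[OF pm eq] by blast
  have inj: "inj_on \<phi> V" and img: "\<phi> ` V = V'"
    using \<phi>(1) by (auto simp: bij_betw_def)
  have sub: "\<Union>M \<subseteq> V" "M \<subseteq> Pow V" if "perfect_matching V M" for M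
    using perfect_matchingD(3)[OF that] by auto
  show ?thesis
  proof (rule card_inj_on_le)
    \<comment> \<open>Matchings are sets of sets, so injectivity is lifted to edges and once more to
      sets of edges.\<close>
    have "primitive lam \<delta> V P Q \<subseteq> Pow (Pow V)"
      using sub(2) by (auto simp: primitive_def intermediate_def)
    then show "inj_on (\<lambda>M. (`) \<phi> ` M) (primitive lam \<delta> V P Q)"
      by (rule inj_on_subset[OF inj_on_image_Pow[OF inj_on_image_Pow[OF inj]]])
    show "finite (primitive lam \<delta> V' P' Q')"
      using finite_intermediate[OF perfect_matchingD(1)[OF pm(3)]] by (simp add: primitive_def)
    show "(\<lambda>M. (`) \<phi> ` M) ` primitive lam \<delta> V P Q \<subseteq> primitive lam \<delta> V' P' Q'"
    proof
      fix M' assume "M' \<in> (\<lambda>M. (`) \<phi> ` M) ` primitive lam \<delta> V P Q"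
      then obtain M where M: "perfect_matching V M" "proper_part (mtype P M) = \<delta>"
        "proper_part (mtype M Q) = lam" "P \<inter> Q \<inter> M = {}" and M': "M' = (`) \<phi> ` M"
        by (auto simp: primitive_def intermediate_def)
      have "mtype P' M' = mtype P M" "mtype M' Q' = mtype M Q"
        unfolding M' \<phi>(2,3)[symmetric]
        using sub(1)[OF pm(1)] sub(1)[OF pm(2)] sub(1)[OF M(1)]
        by (auto intro!: mtype_image inj_on_subset[OF inj])
      moreover have "perfect_matching V' M'"
        using perfect_matching_image[OF M(1) inj] by (simp only: img M')
      moreover have "P' \<inter> Q' \<inter> M' = (`) \<phi> ` (P \<inter> Q \<inter> M)"
        unfolding M' \<phi>(2,3)[symmetric]
        using inj_on_image_Int[OF inj_on_image_Pow[OF inj], of "P \<inter> Q" M]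
          inj_on_image_Int[OF inj_on_image_Pow[OF inj], of P Q]
          sub(2)[OF pm(1)] sub(2)[OF pm(2)] sub(2)[OF M(1)] by (simp add: le_infI1)
      ultimately show "M' \<in> primitive lam \<delta> V' P' Q'"
        using M(2-4) by (simp add: primitive_def intermediate_def)
    qed
  qed
qed

lemma card_primitive_cong:
  assumes "perfect_matching V P" "perfect_matching V Q"
    "perfect_matching V' P'" "perfect_matching V' Q'" "mtype P Q = mtype P' Q'"
  shows "card (primitive lam \<delta> V P Q) = card (primitive lam \<delta> V' P' Q')"
  using card_primitive_le[OF assms] card_primitive_le[OF assms(3,4,1,2) assms(5)[symmetric]]
  by (rule antisym)

text \<open>The edges of \<open>R\<close> lie in all three matchings, so removing them costs both
  types only 1-parts. As \<open>R\<close> is the whole triple intersection, what is left is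
  primitive.\<close>

lemma card_intermediate_common:
  assumes P: "perfect_matching V P" and Q: "perfect_matching V Q" and R: "R \<subseteq> P \<inter> Q"
  shows "card {M \<in> intermediate lam \<delta> V P Q. P \<inter> Q \<inter> M = R} =
    card (primitive lam \<delta> (V - \<Union>R) (P - R) (Q - R))"
proof (rule bij_betw_same_card)
  let ?V = "V - \<Union>R" and ?P = "P - R" and ?Q = "Q - R"
  have R': "perfect_matching (\<Union>R) R"
    by (rule perfect_matching_subset[OF P]) (use R in blast)
  have P0: "perfect_matching ?V ?P" and Q0: "perfect_matching ?V ?Q"
    by (rule perfect_matching_Diff, rule P Q, use R in blast)+
  have disj: "?V \<inter> \<Union>R = {}"
    by blast
  have PR: "?P \<union> R = P" "?Q \<union> R = Q"
    using R by auto
  have V: "?V \<union> \<Union>R = V"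
    using R perfect_matchingD(3)[OF P] by blast
  have type_eq: "proper_part (mtype P (M \<union> R)) = proper_part (mtype ?P M)"
    "proper_part (mtype (M \<union> R) Q) = proper_part (mtype M ?Q)" if "perfect_matching ?V M" for M
    using proper_part_mtype_Un[OF P0 that R' disj] proper_part_mtype_Un[OF that Q0 R' disj]
    by (simp_all only: PR)
  \<comment> \<open>A matching off the vertices of \<open>R\<close> cannot contain an edge of
    \<open>R\<close>; hence subtracting \<open>R\<close> undoes adding it.\<close>
  have M_R: "M \<inter> R = {}" if "perfect_matching ?V M" for M
  proof -
    have "e \<notin> R" if "e \<in> M" for e
    proof
      assume "e \<in> R"
      then have "e = {}"
        using perfect_matchingD(3)[OF \<open>perfect_matching ?V M\<close>] that by blast
      then show False
        using perfect_matchingD(4)[OF R' \<open>e \<in> R\<close>] by simp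
    qed
    then show ?thesis
      by blast
  qed
  let ?A = "{M \<in> intermediate lam \<delta> V P Q. P \<inter> Q \<inter> M = R}"
  let ?B = "primitive lam \<delta> ?V ?P ?Q"
  show "bij_betw (\<lambda>M. M - R) ?A ?B"
  proof (rule bij_betw_byWitness[where f' = "\<lambda>M. M \<union> R"])
    show "\<forall>M\<in>?A. M - R \<union> R = M"
      by blast
    show "\<forall>M\<in>?B. M \<union> R - R = M"
      using M_R by (fastforce simp: primitive_def intermediate_def)
    show "(\<lambda>M. M - R) ` ?A \<subseteq> ?B"
    proof
      fix N assume "N \<in> (\<lambda>M. M - R) ` ?A"
      then obtain M where M: "perfect_matching V M" "proper_part (mtype P M) = \<delta>"
        "proper_part (mtype M Q) = lam" "P \<inter> Q \<inter> M = R" and N: "N = M - R"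
        by (auto simp: intermediate_def)
      have RM: "R \<subseteq> M"
        using M(4) by blast
      have pmN: "perfect_matching ?V N"
        unfolding N by (rule perfect_matching_Diff[OF M(1) RM])
      have "N \<union> R = M"
        using RM N by blast
      then show "N \<in> ?B"
        using type_eq[OF pmN] pmN M(2-4) by (auto simp: primitive_def intermediate_def N)
    qed
    show "(\<lambda>M. M \<union> R) ` ?B \<subseteq> ?A"
    proof
      fix M assume "M \<in> (\<lambda>M. M \<union> R) ` ?B"
      then obtain N where N: "perfect_matching ?V N" "proper_part (mtype ?P N) = \<delta>"
        "proper_part (mtype N ?Q) = lam" "?P \<inter> ?Q \<inter> N = {}" and M: "M = N \<union> R"
        by (auto simp: primitive_def intermediate_def)
      have "perfect_matching V M"
        using perfect_matching_Un[OF N(1) R' disj] by (simp only: V M)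
      moreover have "P \<inter> Q \<inter> M = R"
        using N(4) M_R[OF N(1)] R unfolding M by blast
      ultimately show "M \<in> ?A"
        using type_eq[OF N(1)] N(2,3) by (simp add: intermediate_def M)
    qed
  qed
qed

text \<open>\<open>R\<close> stands for the common edges that are kept, while the summand depends on
  the number avoided; hence the reflection, which the symmetry of binomial coefficients
  absorbs.\<close>

lemma sum_Pow_card:
  fixes b :: "nat \<Rightarrow> nat"
  assumes "finite T"
  shows "(\<Sum>R\<in>Pow T. b (card T - card R)) = (\<Sum>j\<le>card T. (card T choose j) * b j)"
proof -
  have "(\<Sum>R\<in>Pow T. b (card T - card R)) = (\<Sum>k\<le>card T. \<Sum>R | R \<in> Pow T \<and> card R = k. b (card T - card R))"
    using assms by (intro sum.group[symmetric]) (auto intro: card_mono)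
  also have "\<dots> = (\<Sum>k\<le>card T. (card T choose k) * b (card T - k))"
    using n_subsets[OF assms] by (intro sum.cong) auto
  also have "\<dots> = (\<Sum>j\<le>card T. (card T choose (card T - j)) * b j)"
    by (rule sum.reindex_bij_witness[of _ "\<lambda>j. card T - j" "\<lambda>j. card T - j"]) auto
  also have "\<dots> = (\<Sum>j\<le>card T. (card T choose j) * b j)"
    by (intro sum.cong) (simp_all add: binomial_symmetric[symmetric])
  finally show ?thesis .
qed

text \<open>The numbers \<open>b\<close> are chosen before \<open>V\<close>, \<open>P\<close> and
  \<open>Q\<close>: this order of quantifiers carries the independence of n. They may depend on
  \<pi>, \<open>lam\<close> and \<delta>.\<close>

lemma card_intermediate:
  fixes lam \<delta> \<pi> :: "nat multiset"
  shows "\<exists>b :: nat \<Rightarrow> nat. (\<forall>j. b j \<noteq> 0 \<longrightarrow> \<Sum>\<^sub># \<pi> + j \<le> \<Sum>\<^sub># lam + \<Sum>\<^sub># \<delta>) \<and>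
    (\<forall>(V :: 'a set) P Q. perfect_matching V P \<longrightarrow> perfect_matching V Q \<longrightarrow>
      proper_part (mtype P Q) = \<pi> \<longrightarrow>
      card (intermediate lam \<delta> V P Q) =
        (\<Sum>j\<le>card P - \<Sum>\<^sub># \<pi>. (card P - \<Sum>\<^sub># \<pi> choose j) * b j))"
proof -
  \<comment> \<open>The value is read off from any one pair of type \<pi> with j ones added; if
    there is no such pair, 0 will do.\<close>
  have "\<exists>c. (c \<noteq> 0 \<longrightarrow> \<Sum>\<^sub># \<pi> + j \<le> \<Sum>\<^sub># lam + \<Sum>\<^sub># \<delta>) \<and>
    (\<forall>(V :: 'a set) P Q. perfect_matching V P \<longrightarrow> perfect_matching V Q \<longrightarrow>
      mtype P Q = \<pi> + replicate_mset j 1 \<longrightarrow> card (primitive lam \<delta> V P Q) = c)" for j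
  proof (cases "\<exists>(V :: 'a set) P Q. perfect_matching V P \<and> perfect_matching V Q \<and>
      mtype P Q = \<pi> + replicate_mset j 1")
    case True
    then obtain V :: "'a set" and P Q where VPQ: "perfect_matching V P" "perfect_matching V Q"
      "mtype P Q = \<pi> + replicate_mset j 1"
      by blast
    interpret matching_pair V P Q
      using VPQ(1,2) by unfold_locales
    show ?thesis
    proof (intro exI conjI allI impI)
      assume "card (primitive lam \<delta> V P Q) \<noteq> 0"
      then obtain M where "M \<in> primitive lam \<delta> V P Q"
        by (metis card.empty equals0I)
      then have "card P \<le> \<Sum>\<^sub># lam + \<Sum>\<^sub># \<delta>"
        by (rule primitive_bound[OF VPQ(1,2)])
      then show "\<Sum>\<^sub># \<pi> + j \<le> \<Sum>\<^sub># lam + \<Sum>\<^sub># \<delta>"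
        using sum_mtype VPQ(3) by simp
    qed (use card_primitive_cong VPQ in metis)
  qed (intro exI[of _ 0], blast)
  then obtain b where b: "\<And>j. b j \<noteq> 0 \<Longrightarrow> \<Sum>\<^sub># \<pi> + j \<le> \<Sum>\<^sub># lam + \<Sum>\<^sub># \<delta>"
    "\<And>j (V :: 'a set) P Q. perfect_matching V P \<Longrightarrow> perfect_matching V Q \<Longrightarrow>
      mtype P Q = \<pi> + replicate_mset j 1 \<Longrightarrow> card (primitive lam \<delta> V P Q) = b j"
    by metis
  have "card (intermediate lam \<delta> V P Q) = (\<Sum>j\<le>card P - \<Sum>\<^sub># \<pi>. (card P - \<Sum>\<^sub># \<pi> choose j) * b j)"
    if P: "perfect_matching V P" and Q: "perfect_matching V Q" and \<pi>: "proper_part (mtype P Q) = \<pi>"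
    for V :: "'a set" and P Q
  proof -
    interpret matching_pair V P Q
      using P Q by unfold_locales
    let ?T = "P \<inter> Q" and ?I = "intermediate lam \<delta> V P Q"
    have fT: "finite ?T"
      using perfect_matchingD(2)[OF P] by simp
    have "card P = \<Sum>\<^sub># \<pi> + card ?T"
      using sum_proper_part[of "mtype P Q"] unfolding sum_mtype count_mtype_1 \<pi> .
    then have cT: "card ?T = card P - \<Sum>\<^sub># \<pi>"
      by linarith
    have "card ?I = (\<Sum>R\<in>Pow ?T. card {M \<in> ?I. ?T \<inter> M = R})"
    proof -
      have "?I = (\<Union>R\<in>Pow ?T. {M \<in> ?I. ?T \<inter> M = R})"
      proof (intro equalityI subsetI)
        fix M assume "M \<in> ?I"
        then show "M \<in> (\<Union>R\<in>Pow ?T. {M \<in> ?I. ?T \<inter> M = R})"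
          by (intro UN_I[of "?T \<inter> M"]) auto
      qed simp
      also have "card \<dots> = (\<Sum>R\<in>Pow ?T. card {M \<in> ?I. ?T \<inter> M = R})"
      proof (rule card_UN_disjoint)
        show "finite (Pow ?T)"
          using fT by (simp only: finite_Pow_iff)
        show "\<forall>R\<in>Pow ?T. finite {M \<in> ?I. ?T \<inter> M = R}"
          using finite_intermediate[OF finite_V] by simp
      qed auto
      finally show ?thesis .
    qed
    also have "\<dots> = (\<Sum>R\<in>Pow ?T. b (card ?T - card R))"
    proof (rule sum.cong[OF refl])
      fix R assume "R \<in> Pow ?T"
      then have R: "R \<subseteq> ?T"
        by blast
      have P0: "perfect_matching (V - \<Union>R) (P - R)" and Q0: "perfect_matching (V - \<Union>R) (Q - R)"
        by (rule perfect_matching_Diff, rule P Q, use R in blast)+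
      have R': "perfect_matching (\<Union>R) R"
        by (rule perfect_matching_subset[OF P]) (use R in blast)
      interpret I: matching_pair "V - \<Union>R" "P - R" "Q - R"
        using P0 Q0 by unfold_locales
      have "P - R \<union> R = P" "Q - R \<union> R = Q"
        using R by auto
      then have "proper_part (mtype (P - R) (Q - R)) = \<pi>"
        using proper_part_mtype_Un[OF P0 Q0 R'] \<pi> by (simp add: Diff_Int_distrib2)
      moreover have "count (mtype (P - R) (Q - R)) 1 = card ?T - card R"
      proof -
        have "(P - R) \<inter> (Q - R) = ?T - R"
          by blast
        then show ?thesis
          unfolding I.count_mtype_1 using card_Diff_subset[OF finite_subset[OF R fT] R] by (simp only:)
      qed
      \<comment> \<open>Only the cardinality of \<open>R\<close> enters this type, so the primitive
        count does not see which edges were removed.\<close>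
      ultimately have "mtype (P - R) (Q - R) = \<pi> + replicate_mset (card ?T - card R) 1"
        using proper_part_add[of "mtype (P - R) (Q - R)"] by (simp only:)
      then show "card {M \<in> ?I. ?T \<inter> M = R} = b (card ?T - card R)"
        using card_intermediate_common[OF P Q R] b(2)[OF P0 Q0] by simp
    qed
    also have "\<dots> = (\<Sum>j\<le>card ?T. (card ?T choose j) * b j)"
      by (rule sum_Pow_card[OF fT])
    finally show ?thesis
      by (simp only: cT)
  qed
  then show ?thesis
    using b(1) by blast
qed

section \<open>From permutations to matchings\<close>

lemma card_label_pairs: "card (label_pairs n) = n"
  using card_perfect_matching[OF perfect_matching_label_pairs[of n]] by simp

definition interior_matching :: "nat \<Rightarrow> (nat \<Rightarrow> nat) \<Rightarrow> nat set set" where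
  "interior_matching n \<omega> = (`) (inv \<omega>) ` label_pairs n"

lemma perfect_matching_interior:
  assumes "\<omega> permutes {1..2 * n}"
  shows "perfect_matching {1..2 * n} (interior_matching n \<omega>)"
proof -
  have inv: "inv \<omega> permutes {1..2 * n}"
    by (rule permutes_inv[OF assms])
  have "perfect_matching (inv \<omega> ` {1..2 * n}) ((`) (inv \<omega>) ` label_pairs n)"
    by (rule perfect_matching_image[OF perfect_matching_label_pairs permutes_inj_on[OF inv]])
  then show ?thesis
    by (simp only: permutes_image[OF inv] interior_matching_def)
qed

text \<open>Describes the permutations with a given interior matching as those carrying it to the
  label pairs, the form in which they have been counted.\<close>

lemma interior_matching_eq_iff:
  assumes "\<omega> permutes S"
  shows "interior_matching n \<omega> = M \<longleftrightarrow> (`) \<omega> ` M = label_pairs n"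
proof
  have l: "inv \<omega> (\<omega> x) = x" and r: "\<omega> (inv \<omega> x) = x" for x
    using permutes_inverses[OF assms] by auto
  show "(`) \<omega> ` M = label_pairs n" if "interior_matching n \<omega> = M"
    unfolding that[symmetric] interior_matching_def by (simp add: image_image r)
  show "interior_matching n \<omega> = M" if "(`) \<omega> ` M = label_pairs n"
    unfolding that[symmetric] interior_matching_def by (simp add: image_image l)
qed

text \<open>Vertices whose interior labels form a pair are the preimage of that pair. The
  restriction of both edge relations to the vertex set agrees with adjacency because all edges lie
  there.\<close>

lemma coset_type_eq_mtype:
  assumes "\<omega> permutes {1..2 * n}"
  shows "coset_type n \<omega> = mtype (label_pairs n) (interior_matching n \<omega>)"
proof -
  let ?V = "{1..2 * n}" and ?E = "label_pairs n" and ?N = "interior_matching n \<omega>"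
  interpret matching_pair ?V ?E ?N
    using perfect_matching_label_pairs perfect_matching_interior[OF assms] by unfold_locales
  have sub: "{i, j} \<subseteq> ?V" if "{i, j} \<in> ?E \<union> ?N" for i j
    using Union_upper[OF that] by (simp only: Union_edges)
  have "exterior_edges n = adj ?E"
    unfolding exterior_edges_def adj_def using sub by blast
  moreover have "interior_edges n \<omega> = adj ?N"
  proof -
    have l: "inv \<omega> (\<omega> x) = x" for x
      using permutes_inverses[OF assms] by auto
    have "{\<omega> i, \<omega> j} \<in> ?E \<longleftrightarrow> {i, j} \<in> ?N" for i j
    proof
      assume "{\<omega> i, \<omega> j} \<in> ?E"
      then have "inv \<omega> ` {\<omega> i, \<omega> j} \<in> ?N"
        unfolding interior_matching_def by (rule imageI)
      then show "{i, j} \<in> ?N"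
        by (simp add: l)
    next
      assume "{i, j} \<in> ?N"
      then have "\<omega> ` {i, j} \<in> (`) \<omega> ` ?N"
        by (rule imageI)
      then show "{\<omega> i, \<omega> j} \<in> ?E"
        using interior_matching_eq_iff[OF assms, of n ?N] by simp
    qed
    then show ?thesis
      unfolding interior_edges_def adj_def using sub by blast
  qed
  ultimately have "exterior_edges n \<union> interior_edges n \<omega> = adj (?E \<union> ?N)"
    by (auto simp: adj_def)
  then have "coset_graph_components n \<omega> = comps (?E \<union> ?N)"
    unfolding coset_graph_components_def quotient_def comps_def component_def Union_edges by auto
  then show ?thesis
    by (simp add: coset_type_def mtype_def)
qed

lemma sum_coset_type:
  assumes "\<omega> permutes {1..2 * n}"
  shows "\<Sum>\<^sub># (coset_type n \<omega>) = n"
proof -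
  interpret matching_pair "{1..2 * n}" "label_pairs n" "interior_matching n \<omega>"
    using perfect_matching_label_pairs perfect_matching_interior[OF assms] by unfold_locales
  show ?thesis
    by (simp only: coset_type_eq_mtype[OF assms] sum_mtype card_label_pairs)
qed

lemma proper_part_coset_type:
  assumes "\<omega> permutes {1..2 * n}"
  shows "proper_partition (proper_part (coset_type n \<omega>))"
    and "\<Sum>\<^sub># (proper_part (coset_type n \<omega>)) \<le> n"
proof -
  interpret matching_pair "{1..2 * n}" "label_pairs n" "interior_matching n \<omega>"
    using perfect_matching_label_pairs perfect_matching_interior[OF assms] by unfold_locales
  show "proper_partition (proper_part (coset_type n \<omega>))"
    unfolding coset_type_eq_mtype[OF assms] by (rule proper_partition_mtype)
  show "\<Sum>\<^sub># (proper_part (coset_type n \<omega>)) \<le> n"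
    using sum_proper_part[of "coset_type n \<omega>"] sum_coset_type[OF assms] by linarith
qed

section \<open>Class sums and their products\<close>

lemma K_sum_permutes:
  assumes "proper_partition \<pi>" "\<Sum>\<^sub># \<pi> \<le> n" "\<omega> permutes {1..2 * n}"
  shows "K_sum \<pi> n \<omega> = (if proper_part (coset_type n \<omega>) = \<pi> then 1 else 0)"
  using proper_part_eq_iff[OF assms(1), of "coset_type n \<omega>"] assms(2,3)
  unfolding K_sum_def sum_coset_type[OF assms(3)] by simp

text \<open>A pair of the padded type is relabelled so that its first matching becomes \<epsilon>;
  any permutation carrying the second one to \<epsilon> has the required type.\<close>

lemma exists_permutation_proper_part:
  assumes "proper_partition \<pi>" "\<Sum>\<^sub># \<pi> \<le> n"
  shows "\<exists>\<omega>. \<omega> permutes {1..2 * n} \<and> proper_part (coset_type n \<omega>) = \<pi>"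
proof -
  let ?V = "{1..2 * n}" and ?E = "label_pairs n"
  define T where "T = \<pi> + replicate_mset (n - \<Sum>\<^sub># \<pi>) 1"
  have sT: "\<Sum>\<^sub># T = n"
    using assms(2) by (simp add: T_def)
  have "0 \<notin># T"
    using assms(1) by (auto simp: T_def proper_partition_def is_partition_def)
  then obtain W P Q where WPQ: "perfect_matching (W :: nat set) P" "perfect_matching W Q" "mtype P Q = T"
    using exists_type by blast
  interpret matching_pair W P Q
    using WPQ(1,2) by unfold_locales
  have "card P = n"
    using sum_mtype WPQ(3) sT by simp
  \<comment> \<open>The relabelling is obtained from its count being non-zero, as is the permutation
    below.\<close>
  then have "card (isos W P ?V ?E) \<noteq> 0"
    using card_isos[OF WPQ(1) perfect_matching_label_pairs[of n] _ card_label_pairs] by simp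
  then obtain h where h: "bij_betw h W ?V" "(`) h ` P = ?E"
    by (auto simp: isos_def dest!: card_gt_0_iff[THEN iffD1] intro: ccontr)
  have inj: "inj_on h W"
    using h(1) by (rule bij_betw_imp_inj_on)
  define N where "N = (`) h ` Q"
  have N: "perfect_matching ?V N"
    using perfect_matching_image[OF WPQ(2) inj] h(1) by (simp add: N_def bij_betw_def)
  have "mtype ?E N = T"
    using mtype_image[of h P Q] inj unfolding Union_edges h(2) WPQ(3) N_def by blast
  moreover have "card {\<tau>. \<tau> permutes ?V \<and> (`) \<tau> ` N = ?E} \<noteq> 0"
    using card_permutes_matching[OF N perfect_matching_label_pairs] by simp
  then obtain \<omega> where \<omega>: "\<omega> permutes ?V" "(`) \<omega> ` N = ?E"
    by (metis (mono_tags, lifting) card.empty empty_Collect_eq)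
  ultimately have "coset_type n \<omega> = T"
    using coset_type_eq_mtype[OF \<omega>(1)] interior_matching_eq_iff[OF \<omega>(1), of n N] by simp
  then have "proper_part (coset_type n \<omega>) = \<pi>"
    using proper_part_eq_iff[OF assms(1), of T] assms(2) sT by (simp add: T_def)
  then show ?thesis
    using \<omega>(1) by blast
qed

text \<open>A factorisation of \<omega> is determined by its right factor \<tau>, and the conditions
  on \<tau> depend only on its interior matching; the sum therefore splits into fibres of equal
  size.\<close>

lemma group_algebra_mult_K_sum:
  assumes "proper_partition lam" "\<Sum>\<^sub># lam \<le> n" "proper_partition \<delta>" "\<Sum>\<^sub># \<delta> \<le> n"
    and \<omega>: "\<omega> permutes {1..2 * n}"
  shows "group_algebra_mult n (K_sum lam n) (K_sum \<delta> n) \<omega> = of_nat (2 ^ n * fact n *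
    card (intermediate lam \<delta> {1..2 * n} (label_pairs n) (interior_matching n \<omega>)))"
proof -
  let ?V = "{1..2 * n}" and ?E = "label_pairs n" and ?N = "interior_matching n \<omega>"
  let ?I = "intermediate lam \<delta> ?V ?E ?N"
  let ?S = "{(\<sigma>, \<tau>). \<sigma> permutes ?V \<and> \<tau> permutes ?V \<and> \<sigma> \<circ> \<tau> = \<omega>}"
  let ?T = "{\<tau>. \<tau> permutes ?V \<and> proper_part (coset_type n (\<omega> \<circ> inv \<tau>)) = lam \<and>
    proper_part (coset_type n \<tau>) = \<delta>}"
  let ?fibre = "\<lambda>M. {\<tau>. \<tau> permutes ?V \<and> (`) \<tau> ` M = ?E}"
  have fibre: "?fibre M = {\<tau>. \<tau> permutes ?V \<and> interior_matching n \<tau> = M}" for M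
    by (rule Collect_cong, rule conj_cong[OF refl], rule interior_matching_eq_iff[symmetric])
  have finP: "finite {\<tau>. \<tau> permutes ?V}"
    by (rule finite_permutations) simp
  have S: "?S = (\<lambda>\<tau>. (\<omega> \<circ> inv \<tau>, \<tau>)) ` {\<tau>. \<tau> permutes ?V}"
  proof (intro equalityI subsetI)
    fix p assume "p \<in> ?S"
    then obtain \<sigma> \<tau> where p: "p = (\<sigma>, \<tau>)" "\<tau> permutes ?V" "\<sigma> \<circ> \<tau> = \<omega>"
      by blast
    have "\<omega> \<circ> inv \<tau> = \<sigma>"
      unfolding p(3)[symmetric] by (simp add: comp_assoc permutes_inv_o[OF p(2)])
    then show "p \<in> (\<lambda>\<tau>. (\<omega> \<circ> inv \<tau>, \<tau>)) ` {\<tau>. \<tau> permutes ?V}"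
      using p(1,2) by auto
  next
    fix p assume "p \<in> (\<lambda>\<tau>. (\<omega> \<circ> inv \<tau>, \<tau>)) ` {\<tau>. \<tau> permutes ?V}"
    then obtain \<tau> where "\<tau> permutes ?V" "p = (\<omega> \<circ> inv \<tau>, \<tau>)"
      by blast
    then show "p \<in> ?S"
      using permutes_compose[OF permutes_inv \<omega>] by (simp add: comp_assoc permutes_inv_o)
  qed
  have "group_algebra_mult n (K_sum lam n) (K_sum \<delta> n) \<omega> =
    (\<Sum>\<tau> | \<tau> permutes ?V. K_sum lam n (\<omega> \<circ> inv \<tau>) * K_sum \<delta> n \<tau>)"
    unfolding group_algebra_mult_def S by (subst sum.reindex) (auto simp: inj_on_def)
  also have "\<dots> = (\<Sum>\<tau> | \<tau> permutes ?V. if \<tau> \<in> ?T then 1 else 0)"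
  proof (rule sum.cong[OF refl])
    fix \<tau> assume "\<tau> \<in> {\<tau>. \<tau> permutes ?V}"
    then have \<tau>: "\<tau> permutes ?V"
      by simp
    have "\<omega> \<circ> inv \<tau> permutes ?V"
      by (rule permutes_compose[OF permutes_inv[OF \<tau>] \<omega>])
    then show "K_sum lam n (\<omega> \<circ> inv \<tau>) * K_sum \<delta> n \<tau> = (if \<tau> \<in> ?T then 1 else 0)"
      using \<tau> by (simp add: K_sum_permutes assms(1-4))
  qed
  also have "\<dots> = of_nat (card ?T)"
    using finP by (simp add: sum.If_cases Int_def conj_commute cong: conj_cong)
  also have "card ?T = card (\<Union>M\<in>?I. ?fibre M)"
  proof -
    have "\<tau> \<in> ?T \<longleftrightarrow> interior_matching n \<tau> \<in> ?I" if \<tau>: "\<tau> permutes ?V" for \<tau>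
    proof -
      let ?M = "interior_matching n \<tau>"
      have M: "perfect_matching ?V ?M"
        by (rule perfect_matching_interior[OF \<tau>])
      have \<sigma>: "\<omega> \<circ> inv \<tau> permutes ?V"
        by (rule permutes_compose[OF permutes_inv[OF \<tau>] \<omega>])
      have "inv (\<omega> \<circ> inv \<tau>) = \<tau> \<circ> inv \<omega>"
        using o_inv_distrib[OF permutes_bij[OF \<omega>] permutes_bij[OF permutes_inv[OF \<tau>]]]
        by (simp add: permutes_inv_inv[OF \<tau>])
      then have "interior_matching n (\<omega> \<circ> inv \<tau>) = (`) \<tau> ` ?N"
        by (simp add: interior_matching_def image_image image_comp[symmetric])
      moreover have "?E = (`) \<tau> ` ?M"
        using interior_matching_eq_iff[OF \<tau>, of n ?M] by simp
      \<comment> \<open>Relabelling by \<tau> turns (M, N) into the pair that defines the type of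
        the left factor.\<close>
      ultimately have "coset_type n (\<omega> \<circ> inv \<tau>) = mtype ((`) \<tau> ` ?M) ((`) \<tau> ` ?N)"
        using coset_type_eq_mtype[OF \<sigma>] by simp
      also have "\<dots> = mtype ?M ?N"
        by (rule mtype_image[OF permutes_inj_on[OF \<tau>]])
      finally show ?thesis
        using \<tau> M by (auto simp: intermediate_def coset_type_eq_mtype)
    qed
    then have "?T = {\<tau>. \<tau> permutes ?V \<and> interior_matching n \<tau> \<in> ?I}"
      by blast
    also have "\<dots> = (\<Union>M\<in>?I. ?fibre M)"
      unfolding fibre by blast
    finally show ?thesis
      by (rule arg_cong)
  qed
  also have "\<dots> = (\<Sum>M\<in>?I. card (?fibre M))"
  proof (rule card_UN_disjoint)
    show "finite ?I"
      by (rule finite_intermediate) simp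
    show "\<forall>M\<in>?I. finite (?fibre M)"
      using finP by (auto intro: finite_subset)
    show "\<forall>M\<in>?I. \<forall>M'\<in>?I. M \<noteq> M' \<longrightarrow> ?fibre M \<inter> ?fibre M' = {}"
      unfolding fibre by blast
  qed
  also have "\<dots> = (\<Sum>M\<in>?I. 2 ^ n * fact n)"
  proof (rule sum.cong[OF refl])
    fix M assume "M \<in> ?I"
    then have M: "perfect_matching ?V M"
      by (simp add: intermediate_def)
    then have "card M = n"
      using card_perfect_matching[OF M] by simp
    then show "card (?fibre M) = 2 ^ n * fact n"
      using card_permutes_matching[OF M perfect_matching_label_pairs] by simp
  qed
  also have "\<dots> = 2 ^ n * fact n * card ?I"
    by simp
  finally show ?thesis .
qed

section \<open>The structure coefficients\<close>

text \<open>At a permutation exactly one of the class sums in the index set is non-zero, so the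
  coefficients are the values of the product. Every admissible proper type is attained, which leaves
  no freedom.\<close>

lemma structure_coeff_eq:
  assumes lam: "proper_partition lam" "\<Sum>\<^sub># lam \<le> n" and \<delta>: "proper_partition \<delta>" "\<Sum>\<^sub># \<delta> \<le> n"
    and g: "\<And>\<omega>. \<omega> permutes {1..2 * n} \<Longrightarrow>
      card (intermediate lam \<delta> {1..2 * n} (label_pairs n) (interior_matching n \<omega>)) =
        g (proper_part (coset_type n \<omega>))"
    and \<rho>: "proper_partition \<rho>"
  shows "structure_coeff lam \<delta> \<rho> n = (if \<Sum>\<^sub># \<rho> \<le> n then of_nat (2 ^ n * fact n * g \<rho>) else 0)"
proof -
  let ?V = "{1..2 * n}"
  let ?S = "{\<pi>. proper_partition \<pi> \<and> \<Sum>\<^sub># \<pi> \<le> n}"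
  let ?prod = "group_algebra_mult n (K_sum lam n) (K_sum \<delta> n)"
  define c :: "nat multiset \<Rightarrow> complex" where
    "c \<pi> = (if \<pi> \<in> ?S then of_nat (2 ^ n * fact n * g \<pi>) else 0)" for \<pi>
  \<comment> \<open>A sum over an infinite index set would be 0 by convention; finiteness comes from
    realising each index by one of finitely many permutations.\<close>
  have "?S \<subseteq> (\<lambda>\<omega>. proper_part (coset_type n \<omega>)) ` {\<omega>. \<omega> permutes ?V}"
    using exists_permutation_proper_part[of _ n] by blast
  then have fin: "finite ?S"
    by (rule finite_subset) (intro finite_imageI finite_permutations, simp)
  have expand: "(\<Sum>\<pi>\<in>?S. d \<pi> * K_sum \<pi> n \<omega>) = d (proper_part (coset_type n \<omega>))"
    if \<omega>: "\<omega> permutes ?V" for d :: "nat multiset \<Rightarrow> complex" and \<omega>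
  proof -
    have "(\<Sum>\<pi>\<in>?S. d \<pi> * K_sum \<pi> n \<omega>) =
      (\<Sum>\<pi>\<in>?S. if proper_part (coset_type n \<omega>) = \<pi> then d \<pi> else 0)"
      by (rule sum.cong) (auto simp: K_sum_permutes[OF _ _ \<omega>])
    also have "\<dots> = d (proper_part (coset_type n \<omega>))"
      using fin proper_part_coset_type[OF \<omega>] by simp
    finally show ?thesis .
  qed
  have prod: "?prod \<omega> = c (proper_part (coset_type n \<omega>))" if \<omega>: "\<omega> permutes ?V" for \<omega>
    using group_algebra_mult_K_sum[OF lam \<delta> \<omega>] g[OF \<omega>] proper_part_coset_type[OF \<omega>]
    by (simp add: c_def)
  have "(THE d. ?prod = (\<lambda>\<omega>. \<Sum>\<pi>\<in>?S. d \<pi> * K_sum \<pi> n \<omega>) \<and> (\<forall>\<pi>. \<pi> \<notin> ?S \<longrightarrow> d \<pi> = 0)) = c"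
  proof (rule the_equality, intro conjI ext allI impI)
    fix \<omega>
    show "?prod \<omega> = (\<Sum>\<pi>\<in>?S. c \<pi> * K_sum \<pi> n \<omega>)"
    proof (cases "\<omega> permutes ?V")
      case True
      then show ?thesis
        using prod expand by simp
    next
      case False
      \<comment> \<open>A product of permutations is a permutation, so at any other function the
        defining sum is empty.\<close>
      then have "{(\<sigma>, \<tau>). \<sigma> permutes ?V \<and> \<tau> permutes ?V \<and> \<sigma> \<circ> \<tau> = \<omega>} = {}"
        using permutes_compose by blast
      then have "?prod \<omega> = 0"
        unfolding group_algebra_mult_def by (simp only: sum.empty)
      then show ?thesis
        using False by (simp add: K_sum_def)
    qed
  next
    fix \<pi> assume "\<pi> \<notin> ?S"
    then show "c \<pi> = 0"
      unfolding c_def by (rule if_not_P)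
  next
    fix d assume d: "?prod = (\<lambda>\<omega>. \<Sum>\<pi>\<in>?S. d \<pi> * K_sum \<pi> n \<omega>) \<and> (\<forall>\<pi>. \<pi> \<notin> ?S \<longrightarrow> d \<pi> = 0)"
    show "d = c"
    proof
      fix \<pi>
      show "d \<pi> = c \<pi>"
      proof (cases "\<pi> \<in> ?S")
        case True
        \<comment> \<open>Evaluating the expansion at a permutation of proper type \<pi> isolates
          \<open>d \<pi>\<close>.\<close>
        then obtain \<omega> where \<omega>: "\<omega> permutes ?V" "proper_part (coset_type n \<omega>) = \<pi>"
          using exists_permutation_proper_part by blast
        have "d \<pi> = ?prod \<omega>"
          using d expand[OF \<omega>(1)] \<omega>(2) by simp
        then show ?thesis
          using prod[OF \<omega>(1)] \<omega>(2) by simp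
      next
        case False
        then have "c \<pi> = 0"
          unfolding c_def by (rule if_not_P)
        with False show ?thesis
          using d by metis
      qed
    qed
  qed
  then have "structure_coeff lam \<delta> \<rho> n = c \<rho>"
    unfolding structure_coeff_def by simp
  then show ?thesis
    using \<rho> by (simp add: c_def)
qed

text \<open>Since s \<le> n, the rational difference is the natural number n - s. For j > n - s both
  sides vanish.\<close>

lemma falling_factorial_of_nat:
  assumes "s \<le> n"
  shows "falling_factorial (of_nat n - of_nat s :: rat) j = of_nat ((n - s) choose j) * fact j"
proof -
  have "falling_factorial (of_nat (n - s) :: rat) j = (of_nat (n - s) gchoose j) * fact j"
    by (simp add: falling_factorial_def gbinomial_prod_rev atLeast0LessThan)
  then show ?thesis
    using assms by (simp add: of_nat_diff binomial_gbinomial)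
qed

theorem theorem2p1:
  fixes lam \<delta> \<rho> :: "nat multiset"
  assumes "proper_partition lam" and "proper_partition \<delta>" and "proper_partition \<rho>"
  shows "\<exists>(a :: nat \<Rightarrow> rat) (f :: rat poly).
    (\<forall>j. a j \<ge> 0) \<and>
    (\<forall>x. poly f x = (\<Sum>j | int j \<le> int (\<Sum>\<^sub># lam) + int (\<Sum>\<^sub># \<delta>) - int (\<Sum>\<^sub># \<rho>).
                         a j * falling_factorial (x - of_nat (\<Sum>\<^sub># \<rho>)) j)) \<and>
    (\<forall>n \<ge> max (\<Sum>\<^sub># lam) (\<Sum>\<^sub># \<delta>).
       structure_coeff lam \<delta> \<rho> n =
         (if n \<ge> \<Sum>\<^sub># \<rho> then 2 ^ n * fact n * of_rat (poly f (of_nat n)) else 0))"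
proof -
  let ?r = "\<Sum>\<^sub># \<rho>"
  \<comment> \<open>The comparison takes place in the integers, so the index set is empty when
    |\<rho>| exceeds |lam| + |\<delta>|; then f is zero.\<close>
  let ?J = "{j. int j \<le> int (\<Sum>\<^sub># lam) + int (\<Sum>\<^sub># \<delta>) - int ?r}"
  \<comment> \<open>The expansion of the product involves all coset-types of \<omega>, not only that
    of \<rho>; hence one sequence for each \<pi>.\<close>
  obtain b where b: "\<forall>\<pi>. (\<forall>j. b \<pi> j \<noteq> 0 \<longrightarrow> \<Sum>\<^sub># \<pi> + j \<le> \<Sum>\<^sub># lam + \<Sum>\<^sub># \<delta>) \<and>
      (\<forall>(V :: nat set) P Q. perfect_matching V P \<longrightarrow> perfect_matching V Q \<longrightarrow>
        proper_part (mtype P Q) = \<pi> \<longrightarrow> card (intermediate lam \<delta> V P Q) =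
          (\<Sum>j\<le>card P - \<Sum>\<^sub># \<pi>. (card P - \<Sum>\<^sub># \<pi> choose j) * b \<pi> j))"
    using choice[OF allI[OF card_intermediate[where lam = lam and \<delta> = \<delta> and 'a = nat]]]
    by (rule exE)
  have bound: "\<Sum>\<^sub># \<pi> + j \<le> \<Sum>\<^sub># lam + \<Sum>\<^sub># \<delta>" if "b \<pi> j \<noteq> 0" for \<pi> j
    using b that by (elim allE[of _ \<pi>]) blast
  have count: "card (intermediate lam \<delta> V P Q) =
      (\<Sum>j\<le>card P - \<Sum>\<^sub># \<pi>. (card P - \<Sum>\<^sub># \<pi> choose j) * b \<pi> j)"
    if "perfect_matching V P" "perfect_matching V Q" "proper_part (mtype P Q) = \<pi>"
    for \<pi> and V :: "nat set" and P Q
    using b[rule_format, THEN conjunct2, rule_format, OF that] .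
  define a :: "nat \<Rightarrow> rat" where "a j = of_nat (b \<rho> j) / fact j" for j
  define f :: "rat poly" where
    "f = (\<Sum>j\<in>?J. smult (a j) (\<Prod>i<j. [:- of_nat ?r - of_nat i, 1:]))"
  have poly_f: "poly f x = (\<Sum>j\<in>?J. a j * falling_factorial (x - of_nat ?r) j)" for x
    by (simp add: f_def poly_sum poly_prod falling_factorial_def algebra_simps)
  have finJ: "finite ?J"
  proof (rule finite_subset)
    show "?J \<subseteq> {..\<Sum>\<^sub># lam + \<Sum>\<^sub># \<delta>}"
    proof
      fix j assume "j \<in> ?J"
      then have "int j \<le> int (\<Sum>\<^sub># lam) + int (\<Sum>\<^sub># \<delta>) - int ?r"
        by (rule CollectD)
      then have "j \<le> \<Sum>\<^sub># lam + \<Sum>\<^sub># \<delta>"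
        by linarith
      then show "j \<in> {..\<Sum>\<^sub># lam + \<Sum>\<^sub># \<delta>}"
        by simp
    qed
  qed simp
  have coeff: "structure_coeff lam \<delta> \<rho> n =
      (if ?r \<le> n then of_nat (2 ^ n * fact n * (\<Sum>j\<le>n - ?r. (n - ?r choose j) * b \<rho> j)) else 0)"
    if "n \<ge> max (\<Sum>\<^sub># lam) (\<Sum>\<^sub># \<delta>)" for n
  proof (rule structure_coeff_eq[OF assms(1) _ assms(2) _ _ assms(3)])
    show "\<Sum>\<^sub># lam \<le> n" "\<Sum>\<^sub># \<delta> \<le> n"
      using that by auto
    fix \<omega> assume \<omega>: "\<omega> permutes {1..2 * n}"
    show "card (intermediate lam \<delta> {1..2 * n} (label_pairs n) (interior_matching n \<omega>)) =
      (\<lambda>\<pi>. \<Sum>j\<le>n - \<Sum>\<^sub># \<pi>. (n - \<Sum>\<^sub># \<pi> choose j) * b \<pi> j) (proper_part (coset_type n \<omega>))"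
      using count[OF perfect_matching_label_pairs perfect_matching_interior[OF \<omega>] refl]
      by (simp only: card_label_pairs coset_type_eq_mtype[OF \<omega>])
  qed
  have poly_n: "poly f (of_nat n) = of_nat (\<Sum>j\<le>n - ?r. (n - ?r choose j) * b \<rho> j)" if "?r \<le> n" for n
  proof -
    have "poly f (of_nat n) = (\<Sum>j\<in>?J. of_nat ((n - ?r choose j) * b \<rho> j))"
      unfolding poly_f by (rule sum.cong) (simp_all add: a_def falling_factorial_of_nat[OF that] del: of_nat_sum_mset)
    \<comment> \<open>The binomial coefficient vanishes beyond n - |\<rho>| and
      \<open>b \<rho>\<close> beyond the degree bound, so both ranges reduce to their
      intersection.\<close>
    also have "\<dots> = (\<Sum>j\<in>?J \<inter> {..n - ?r}. of_nat ((n - ?r choose j) * b \<rho> j))"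
      using finJ by (intro sum.mono_neutral_right) auto
    also have "\<dots> = (\<Sum>j\<le>n - ?r. of_nat ((n - ?r choose j) * b \<rho> j))"
    proof (rule sum.mono_neutral_left)
      have "b \<rho> j = 0" if "j \<notin> ?J" for j
      proof (rule ccontr)
        assume "b \<rho> j \<noteq> 0"
        then have "int j \<le> int (\<Sum>\<^sub># lam) + int (\<Sum>\<^sub># \<delta>) - int ?r"
          using bound[of \<rho> j] by linarith
        with that show False
          by blast
      qed
      then show "\<forall>j\<in>{..n - ?r} - ?J \<inter> {..n - ?r}. of_nat ((n - ?r choose j) * b \<rho> j) = (0 :: rat)"
        by fastforce
    qed auto
    finally show ?thesis
      by simp
  qed
  have "structure_coeff lam \<delta> \<rho> n =
      (if n \<ge> ?r then 2 ^ n * fact n * of_rat (poly f (of_nat n)) else 0)"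
    if "n \<ge> max (\<Sum>\<^sub># lam) (\<Sum>\<^sub># \<delta>)" for n
  proof (cases "?r \<le> n")
    case True
    show ?thesis
      by (simp only: coeff[OF that] poly_n[OF True] True if_True of_rat_of_nat_eq of_nat_mult
          of_nat_power of_nat_numeral of_nat_fact)
  next
    case False
    then show ?thesis
      by (simp only: coeff[OF that] if_False)
  qed
  moreover have "a j \<ge> 0" for j
    by (simp add: a_def)
  ultimately show ?thesis
    using poly_f by blast
qed

end
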